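(* Let $n\geq 1$ and let $X_1,\dots,X_n$ be a square-integrable martingale difference sequence with respect to a filtration $\mathcal{F}_0,\dots,\mathcal{F}_n$, with $s_n^2>0$. Assume that $V_n^2=s_n^2$ almost surely. Then, for any real $a\geq 0$, $$d_{\mathrm{W}}\bigl(\mathcal{L}(S_n/s_n),\mathrm{N}(0,1)\bigr)\leq \frac{3}{s_n}\sum_{k=1}^n \mathbb{E}\left[\frac{|X_k|^3}{\rho_k^2+a^2}\right]+\frac{2a}{s_n}.$$
   Context: A martingale difference sequence with respect to a filtration $\mathcal{F}_0\subset\dots\subset\mathcal{F}_n$ is a sequence of random variables $X_1,\dots,X_n$ such that $X_k$ is $\mathcal{F}_k$-measurable and $\mathbb{E}(X_k\mid\mathcal{F}_{k-1})=0$ almost surely for $1\leq k\leq n$. Notation: $S_0:=0$ and $S_k:=X_1+\dots+X_k$; $\sigma_k^2:=\mathbb{E}(X_k^2\mid\mathcal{F}_{k-1})$; $\bar\sigma_k^2:=\mathbb{E}X_k^2=\mathbb{E}\sigma_k^2$; $s_n^2:=\operatorname{Var}S_n=\sum_{i=1}^n\bar\sigma_i^2$, with $s_n>0$ its square root; $V_k^2:=\sum_{i=1}^k\sigma_i^2$ for $0\leq k\leq n$; and $\rho_k^2:=V_n^2-V_{k-1}^2=\sum_{i=k}^n\sigma_i^2$ for $1\leq k\leq n+1$ (empty sums are zero). $\mathcal{L}(X)$ denotes the law of $X$, and $\mathrm{N}(0,1)$ the standard normal distribution. The Wasserstein distance between distributions $F,G$ on $\mathbb{R}$ with finite first moments is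 $d_{\mathrm{W}}(F,G)=\sup_h\left|\int h\,dF-\int h\,dG\right|$, the supremum being over all $1$-Lipschitz functions $h:\mathbb{R}\to\mathbb{R}$. The convention $0/0:=0$ is used (relevant only when $a=0$ and $\rho_k^2=0$, in which case $X_k=0$ almost surely on $\{\rho_k^2=0\}$). The right-hand side may be $+\infty$. *)

theory Defs
  imports "HOL-Probability.Probability"
begin

text \<open>The library locale \<open>filtration\<close> needs a whole type as index set; here the filtration is the
  finite family \<open>F 0, \<dots>, F n\<close>, and nothing is said about \<open>F k\<close> for \<open>k > n\<close>.\<close>

definition finite_filtration :: "'a measure \<Rightarrow> nat \<Rightarrow> (nat \<Rightarrow> 'a measure) \<Rightarrow> bool" where
  "finite_filtration M n F \<longleftrightarrow>
     (\<forall>k\<le>n. subalgebra M (F k)) \<and> (\<forall>j\<le>n. \<forall>i\<le>j. subalgebra (F j) (F i))"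

text \<open>Only \<open>X 1, \<dots>, X n\<close> matter. Integrability is required explicitly because \<open>real_cond_exp\<close>
  is a total function, meaningful only for integrable (or nonnegative) arguments.\<close>

definition martingale_difference_sequence ::
    "'a measure \<Rightarrow> nat \<Rightarrow> (nat \<Rightarrow> 'a measure) \<Rightarrow> (nat \<Rightarrow> 'a \<Rightarrow> real) \<Rightarrow> bool" where
  "martingale_difference_sequence M n F X \<longleftrightarrow>
     finite_filtration M n F \<and>
     (\<forall>k\<in>{1..n}. X k \<in> borel_measurable (F k) \<and> integrable M (X k) \<and>
        (AE \<omega> in M. real_cond_exp M (F (k - 1)) (X k) \<omega> = 0))"

definition partial_sum :: "(nat \<Rightarrow> 'a \<Rightarrow> real) \<Rightarrow> nat \<Rightarrow> 'a \<Rightarrow> real" where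
  "partial_sum X k \<omega> = (\<Sum>i=1..k. X i \<omega>)"

text \<open>\<open>cond_var\<close>, \<open>V_sq\<close>, \<open>rho_sq\<close> and \<open>s_sq\<close> denote the squared quantities
  \<open>\<sigma>\<^sub>k\<^sup>2\<close>, \<open>V\<^sub>k\<^sup>2\<close>, \<open>\<rho>\<^sub>k\<^sup>2\<close> and \<open>s\<^sub>n\<^sup>2\<close>.\<close>

definition cond_var ::
    "'a measure \<Rightarrow> (nat \<Rightarrow> 'a measure) \<Rightarrow> (nat \<Rightarrow> 'a \<Rightarrow> real) \<Rightarrow> nat \<Rightarrow> 'a \<Rightarrow> real" where
  "cond_var M F X k = real_cond_exp M (F (k - 1)) (\<lambda>\<omega>. (X k \<omega>)\<^sup>2)"

definition V_sq ::
    "'a measure \<Rightarrow> (nat \<Rightarrow> 'a measure) \<Rightarrow> (nat \<Rightarrow> 'a \<Rightarrow> real) \<Rightarrow> nat \<Rightarrow> 'a \<Rightarrow> real" where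
  "V_sq M F X k \<omega> = (\<Sum>i=1..k. cond_var M F X i \<omega>)"

definition rho_sq ::
    "'a measure \<Rightarrow> nat \<Rightarrow> (nat \<Rightarrow> 'a measure) \<Rightarrow> (nat \<Rightarrow> 'a \<Rightarrow> real) \<Rightarrow> nat \<Rightarrow> 'a \<Rightarrow> real" where
  "rho_sq M n F X k \<omega> = V_sq M F X n \<omega> - V_sq M F X (k - 1) \<omega>"

lemma rho_sq_eq_sum:
  assumes "1 \<le> k" "k \<le> n + 1"
  shows "rho_sq M n F X k \<omega> = (\<Sum>i=k..n. cond_var M F X i \<omega>)"
proof -
  have "{1..n} = {1..k - 1} \<union> {k..n}" "{1..k - 1} \<inter> {k..n} = {}"
    using assms by auto
  then show ?thesis
    by (simp add: rho_sq_def V_sq_def sum.union_disjoint)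
qed

definition s_sq :: "'a measure \<Rightarrow> (nat \<Rightarrow> 'a \<Rightarrow> real) \<Rightarrow> nat \<Rightarrow> real" where
  "s_sq M X n = prob_space.variance M (partial_sum X n)"

text \<open>Taken in \<open>ennreal\<close>, so that the supremum always exists. The integrals are meaningful for
  distributions with finite first moment, where every Lipschitz function is integrable.\<close>

definition wasserstein_dist :: "real measure \<Rightarrow> real measure \<Rightarrow> ennreal" where
  "wasserstein_dist P Q =
     (SUP h \<in> {h :: real \<Rightarrow> real. 1-lipschitz_on UNIV h}.
        ennreal \<bar>(\<integral>x. h x \<partial>P) - (\<integral>x. h x \<partial>Q)\<bar>)"

end

theory Submission
  imports Defs
begin

text \<open>Lindeberg's replacement method with a random time. Let \<open>u\<^sub>t(x) = E h(x + sqrt t Z)\<close> be the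
  Gaussian smoothing of a 1-Lipschitz function \<open>h\<close> and \<open>T\<^sub>k = s\<^sup>2 + a\<^sup>2 - V\<^sub>k\<^sup>2\<close>. As
  \<open>V\<^sub>n\<^sup>2 = s\<^sup>2\<close>, the expectations of \<open>u\<close> at time \<open>T\<^sub>k\<close> and position \<open>S\<^sub>k\<close> interpolate between
  \<open>E h(s Z + a Z')\<close> and \<open>E h(S\<^sub>n + a Z')\<close>, and removing \<open>a Z'\<close> costs at most \<open>a\<close> at each end.
  Since \<open>T\<^sub>k\<close> is known at time \<open>k - 1\<close>, one step compares \<open>u\<^sub>t(x + X)\<close> with
  \<open>u\<^sub>t(x + \<sigma> Z)\<close>, where \<open>X\<close> is centred with variance \<open>\<sigma>\<^sup>2\<close>. The difference is at most
  \<open>3 E|X|\<^sup>3 / (t + \<sigma>\<^sup>2)\<close>: for \<open>t > \<sigma>\<^sup>2 / 2\<close> by a Taylor expansion, the second derivative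
  of \<open>u\<^sub>t\<close> being \<open>2 / t\<close>-Lipschitz, and otherwise because \<open>u\<^sub>t\<close> is 1-Lipschitz. Both estimates are
  proved pathwise up to multiples of \<open>X\<close> and \<open>X\<^sup>2 - \<sigma>\<^sup>2\<close> with coefficients known at
  time \<open>k - 1\<close>, which vanish in conditional mean, so no regular conditional laws are needed.\<close>

subsection \<open>Gaussian integrals\<close>

abbreviation (input) gauss :: "real measure" where
  "gauss \<equiv> std_normal_distribution"

lemma integrable_gauss_iff:
  fixes f :: "real \<Rightarrow> real"
  assumes [measurable]: "f \<in> borel_measurable borel"
  shows "integrable gauss f \<longleftrightarrow> integrable lborel (\<lambda>z. std_normal_density z * f z)"
  by (simp add: integrable_density)

lemma integral_gauss:
  fixes f :: "real \<Rightarrow> real"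
  assumes [measurable]: "f \<in> borel_measurable borel"
  shows "(\<integral>z. f z \<partial>gauss) = (\<integral>z. std_normal_density z * f z \<partial>lborel)"
  by (simp add: integral_density)

lemma prob_space_gauss: "prob_space gauss"
  by (rule prob_space_normal_density) simp

lemma integrable_gauss_power [simp]: "integrable gauss (\<lambda>z. z ^ k)"
  by (simp add: integrable_gauss_iff integrable_std_normal_moment)

lemma integrable_gauss_abs_power [simp]: "integrable gauss (\<lambda>z. \<bar>z\<bar> ^ k)"
  by (simp add: integrable_gauss_iff integrable_std_normal_moment_abs)

lemma integrable_gauss_id [simp]: "integrable gauss (\<lambda>z. z)"
  using integrable_gauss_power[of 1] by simp

lemma integrable_gauss_abs [simp]: "integrable gauss (\<lambda>z. \<bar>z\<bar>)"
  using integrable_gauss_abs_power[of 1] by simp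

lemma integrable_gauss_const [simp]: "integrable gauss (\<lambda>z. c::real)"
proof -
  interpret prob_space gauss by (rule prob_space_gauss)
  show ?thesis by simp
qed

lemma measure_gauss_UNIV [simp]: "measure gauss UNIV = 1"
  using prob_space.prob_space[OF prob_space_gauss] by simp

lemma integral_gauss_const [simp]: "(\<integral>z. (c::real) \<partial>gauss) = c"
  by simp

lemma integral_gauss_id [simp]: "(\<integral>z. z \<partial>gauss) = 0"
  using integral_std_normal_moment_odd[of 0] by (simp add: integral_gauss)

lemma integral_gauss_power2 [simp]: "(\<integral>z. z\<^sup>2 \<partial>gauss) = 1"
  using integral_std_normal_moment_even[of 1] by (simp add: integral_gauss)

lemma integral_gauss_power4: "(\<integral>z. z ^ 4 \<partial>gauss) = 3"
  using integral_std_normal_moment_even[of 2] by (simp add: integral_gauss fact_numeral)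

text \<open>Degree four is large enough for what follows: a Lipschitz function grows linearly, and
  the weights it is multiplied by grow at most quadratically.\<close>

lemma integrable_gauss_bound:
  fixes f :: "real \<Rightarrow> real"
  assumes [measurable]: "f \<in> borel_measurable borel"
    and le: "\<And>z. \<bar>f z\<bar> \<le> A + B * z ^ 4"
  shows "integrable gauss f"
proof (rule Bochner_Integration.integrable_bound)
  show "integrable gauss (\<lambda>z. A + B * z ^ 4)" by simp
  show "AE z in gauss. norm (f z) \<le> norm (A + B * z ^ 4)"
    using le by (intro AE_I2) (metis abs_ge_self order_trans real_norm_def)
qed simp

lemma abs_le_half_square: "\<bar>z\<bar> \<le> (1 + z\<^sup>2) / 2" for z :: real
  using zero_le_power2[of "\<bar>z\<bar> - 1"] by (simp add: power2_diff)

text \<open>AM-GM against the second moment. The value \<open>1\<close> makes each change of time at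
  the two ends cost exactly \<open>a\<close>, hence the final \<open>2 * a\<close>.\<close>

lemma integral_gauss_abs_le: "(\<integral>z. \<bar>z\<bar> \<partial>gauss) \<le> 1"
proof -
  have "(\<integral>z. \<bar>z\<bar> \<partial>gauss) \<le> (\<integral>z. (1 + z\<^sup>2) / 2 \<partial>gauss)"
    by (intro integral_mono abs_le_half_square) auto
  then show ?thesis by simp
qed

text \<open>AM-GM between the second and fourth moments gives \<open>(1 + 3) / 2\<close>. It enters
  \<open>lindeberg_step_bound\<close> as the \<open>2\<close> in
  \<open>r ^ 3 + 2 * s ^ 3\<close>.\<close>

lemma integral_gauss_abs3_le: "(\<integral>z. \<bar>z\<bar> ^ 3 \<partial>gauss) \<le> 2"
proof -
  have "\<bar>z\<bar> ^ 3 \<le> (z\<^sup>2 + z ^ 4) / 2" for z :: real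
  proof -
    have "\<bar>z\<bar> ^ 3 = z\<^sup>2 * \<bar>z\<bar>" by (simp add: power3_eq_cube power2_eq_square)
    also have "\<dots> \<le> z\<^sup>2 * ((1 + z\<^sup>2) / 2)"
      by (intro mult_left_mono abs_le_half_square) simp
    also have "\<dots> = (z\<^sup>2 + z ^ 4) / 2" by (simp add: algebra_simps)
    finally show ?thesis .
  qed
  then have "(\<integral>z. \<bar>z\<bar> ^ 3 \<partial>gauss) \<le> (\<integral>z. (z\<^sup>2 + z ^ 4) / 2 \<partial>gauss)"
    by (intro integral_mono) auto
  then show ?thesis by (simp add: integral_gauss_power4)
qed

lemma lipschitz_abs_le:
  assumes "L-lipschitz_on UNIV (h :: real \<Rightarrow> real)"
  shows "\<bar>h x - h y\<bar> \<le> L * \<bar>x - y\<bar>"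
  using lipschitz_onD[OF assms, of x y] by (simp add: dist_real_def)

lemma lipschitz_measurable [measurable_dest]:
  assumes "L-lipschitz_on UNIV (h :: real \<Rightarrow> real)"
  shows "h \<in> borel_measurable borel"
  using assms by (intro borel_measurable_continuous_onI lipschitz_on_continuous_on)

text \<open>The growth condition on \<open>p\<close> covers the Hermite polynomials
  \<open>1\<close>, \<open>z\<close> and \<open>z\<^sup>2 - 1\<close>, the weights that produce the
  smoothing and its two spatial derivatives.\<close>

lemma integrable_gauss_lipschitz:
  assumes h: "L-lipschitz_on UNIV (h :: real \<Rightarrow> real)"
    and [measurable]: "p \<in> borel_measurable borel"
    and p: "\<And>z. \<bar>p z\<bar> \<le> 1 + z\<^sup>2"
  shows "integrable gauss (\<lambda>z. h (w + c * z) * p z)"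
proof (rule integrable_gauss_bound)
  note [measurable] = lipschitz_measurable[OF h]
  show "(\<lambda>z. h (w + c * z) * p z) \<in> borel_measurable borel" by measurable
  have L: "0 \<le> L" using lipschitz_on_nonneg[OF h] .
  fix z :: real
  define B where "B = \<bar>h w\<bar> + L * \<bar>c\<bar>"
  have B: "0 \<le> B" using L by (simp add: B_def)
  have "\<bar>h (w + c * z)\<bar> \<le> \<bar>h w\<bar> + L * \<bar>c\<bar> * \<bar>z\<bar>"
    using lipschitz_abs_le[OF h, of "w + c * z" w] by (simp add: abs_mult)
  also have "\<dots> \<le> B * (1 + \<bar>z\<bar>)"
    using L by (simp add: B_def algebra_simps)
  also have "\<dots> \<le> B * (2 + z\<^sup>2)"
    using abs_le_half_square[of z] by (intro mult_left_mono B) simp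
  finally have "\<bar>h (w + c * z) * p z\<bar> \<le> B * (2 + z\<^sup>2) * (1 + z\<^sup>2)"
    unfolding abs_mult by (intro mult_mono p) auto
  also have "\<dots> = B * ((2 + z\<^sup>2) * (1 + z\<^sup>2))" by simp
  also have "\<dots> \<le> B * (5 + 5 * z ^ 4)"
  proof (rule mult_left_mono[OF _ B])
    have "2 + 3 * w + w\<^sup>2 \<le> 5 + 5 * w\<^sup>2" for w :: real
      using abs_le_half_square[of w] zero_le_power2[of w] by argo
    from this[of "z\<^sup>2"] show "(2 + z\<^sup>2) * (1 + z\<^sup>2) \<le> 5 + 5 * z ^ 4"
      by (simp add: algebra_simps power2_eq_square power4_eq_xxxx)
  qed
  finally show "\<bar>h (w + c * z) * p z\<bar> \<le> 5 * B + 5 * B * z ^ 4"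
    by (simp add: algebra_simps)
qed

text \<open>With \<open>p = 1\<close>, smoothing preserves the Lipschitz constant; with
  \<open>p = z\<^sup>2 - 1\<close>, second derivatives are Lipschitz, the source of the cubic
  remainder.\<close>

lemma integral_gauss_lipschitz_diff:
  assumes h: "L-lipschitz_on UNIV (h :: real \<Rightarrow> real)"
    and [measurable]: "p \<in> borel_measurable borel"
    and p: "\<And>z. \<bar>p z\<bar> \<le> 1 + z\<^sup>2"
  shows "\<bar>(\<integral>z. h (w + c * z) * p z \<partial>gauss) - (\<integral>z. h (v + c * z) * p z \<partial>gauss)\<bar>
    \<le> L * \<bar>w - v\<bar> * (\<integral>z. \<bar>p z\<bar> \<partial>gauss)"
proof -
  note int = integrable_gauss_lipschitz[OF h assms(2) p]
  have ip: "integrable gauss (\<lambda>z. \<bar>p z\<bar>)"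
  proof (rule Bochner_Integration.integrable_bound)
    show "integrable gauss (\<lambda>z. 1 + z\<^sup>2)" by simp
    show "AE z in gauss. norm \<bar>p z\<bar> \<le> norm (1 + z\<^sup>2)"
      using p by (intro AE_I2) (metis abs_abs abs_ge_self order_trans real_norm_def)
  qed simp
  have "\<bar>(\<integral>z. h (w + c * z) * p z \<partial>gauss) - (\<integral>z. h (v + c * z) * p z \<partial>gauss)\<bar>
    = \<bar>\<integral>z. h (w + c * z) * p z - h (v + c * z) * p z \<partial>gauss\<bar>"
    by (simp only: Bochner_Integration.integral_diff int)
  also have "\<dots> \<le> (\<integral>z. \<bar>h (w + c * z) * p z - h (v + c * z) * p z\<bar> \<partial>gauss)"
    by (rule integral_abs_bound)
  also have "\<dots> \<le> (\<integral>z. L * \<bar>w - v\<bar> * \<bar>p z\<bar> \<partial>gauss)"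
  proof (rule integral_mono)
    show "integrable gauss (\<lambda>z. \<bar>h (w + c * z) * p z - h (v + c * z) * p z\<bar>)"
      by (intro integrable_abs Bochner_Integration.integrable_diff int)
    show "integrable gauss (\<lambda>z. L * \<bar>w - v\<bar> * \<bar>p z\<bar>)"
      by (rule integrable_mult_right[OF ip])
    fix z
    have "\<bar>h (w + c * z) * p z - h (v + c * z) * p z\<bar> = \<bar>h (w + c * z) - h (v + c * z)\<bar> * \<bar>p z\<bar>"
      by (metis abs_mult left_diff_distrib)
    also have "\<dots> \<le> L * \<bar>w - v\<bar> * \<bar>p z\<bar>"
      using lipschitz_abs_le[OF h, of "w + c * z" "v + c * z"] by (intro mult_right_mono) simp_all
    finally show "\<bar>h (w + c * z) * p z - h (v + c * z) * p z\<bar> \<le> L * \<bar>w - v\<bar> * \<bar>p z\<bar>" .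
  qed
  also have "\<dots> = L * \<bar>w - v\<bar> * (\<integral>z. \<bar>p z\<bar> \<partial>gauss)"
    by (rule integral_mult_right_zero)
  finally show ?thesis .
qed

lemma std_normal_density_DERIV:
  "(std_normal_density has_real_derivative - z * std_normal_density z) (at z)"
  unfolding std_normal_density_def[abs_def]
  by (auto intro!: derivative_eq_intros simp: power2_eq_square field_simps)

lemma continuous_on_std_normal_density [continuous_intros]:
  "continuous_on A f \<Longrightarrow> continuous_on A (\<lambda>x. std_normal_density (f x))"
  unfolding std_normal_density_def[abs_def] by (intro continuous_intros) auto

text \<open>The factor \<open>v\<^sup>2 - 1\<close> comes from \<open>\<phi>''(v) = (v\<^sup>2 - 1) \<phi>(v)\<close>.\<close>

lemma std_normal_density_taylor:
  fixes y z :: real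
  defines "k \<equiv> \<lambda>v. (v\<^sup>2 - 1) * std_normal_density v"
  shows "(\<integral>\<theta>. indicator {0..1} \<theta> * ((1 - \<theta>) * (k (z - \<theta> * y) - k z)) \<partial>lborel) * y\<^sup>2
    = std_normal_density (z - y) - std_normal_density z - y * z * std_normal_density z
      - y\<^sup>2 / 2 * k z"
proof -
  \<comment> \<open>With \<open>\<psi> \<theta> = std_normal_density (z - \<theta> * y)\<close>, the
    first two terms are \<open>\<psi> + (1 - \<theta>) \<psi>'\<close>, an antiderivative of
    \<open>(1 - \<theta>) \<psi>''\<close>; the last term integrates the part with the constant
    \<open>k z\<close>.\<close>
  define A where "A \<theta> = std_normal_density (z - \<theta> * y)
    + (1 - \<theta>) * y * ((z - \<theta> * y) * std_normal_density (z - \<theta> * y))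
    + (1 - \<theta>)\<^sup>2 / 2 * y\<^sup>2 * k z" for \<theta>
  have d: "((\<lambda>\<theta>. std_normal_density (z - \<theta> * y)) has_real_derivative
      y * (z - \<theta> * y) * std_normal_density (z - \<theta> * y)) (at \<theta>)" for \<theta>
    by (rule DERIV_cong[OF DERIV_chain2[OF std_normal_density_DERIV]])
      (auto intro!: derivative_eq_intros simp: algebra_simps)
  have A: "(A has_real_derivative y\<^sup>2 * ((1 - \<theta>) * (k (z - \<theta> * y) - k z))) (at \<theta>)" for \<theta>
    unfolding A_def[abs_def] k_def
    by (auto intro!: derivative_eq_intros d simp: field_simps power2_eq_square)
  have "(\<integral>\<theta>. y\<^sup>2 * ((1 - \<theta>) * (k (z - \<theta> * y) - k z)) * indicator {0..1} \<theta> \<partial>lborel) = A 1 - A 0"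
  proof (intro integral_FTC_Icc_real A)
    have "continuous_on UNIV (\<lambda>\<theta>. y\<^sup>2 * ((1 - \<theta>) * (k (z - \<theta> * y) - k z)))"
      unfolding k_def by (intro continuous_intros)
    then show "isCont (\<lambda>\<theta>. y\<^sup>2 * ((1 - \<theta>) * (k (z - \<theta> * y) - k z))) \<theta>" for \<theta>
      by (simp add: continuous_on_eq_continuous_at)
  qed simp
  moreover have "y\<^sup>2 * ((1 - \<theta>) * (k (z - \<theta> * y) - k z)) * indicator {0..1} \<theta>
      = indicator {0..1} \<theta> * ((1 - \<theta>) * (k (z - \<theta> * y) - k z)) * y\<^sup>2" for \<theta>
    by simp
  ultimately have "(\<integral>\<theta>. indicator {0..1} \<theta> * ((1 - \<theta>) * (k (z - \<theta> * y) - k z)) \<partial>lborel) * y\<^sup>2 = A 1 - A 0"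
    by simp
  then show ?thesis by (simp add: A_def)
qed

text \<open>Translation moves from \<open>f\<close>, which need not be differentiable, to the smooth
  density, where it can be expanded.\<close>

lemma integral_gauss_shift:
  fixes f :: "real \<Rightarrow> real"
  assumes [measurable]: "f \<in> borel_measurable borel" "p \<in> borel_measurable borel"
  shows "(\<integral>z. f (z + y) * p z \<partial>gauss) = (\<integral>z. f z * (p (z - y) * std_normal_density (z - y)) \<partial>lborel)"
    and "integrable gauss (\<lambda>z. f (z + y) * p z) \<longleftrightarrow>
      integrable lborel (\<lambda>z. f z * (p (z - y) * std_normal_density (z - y)))"
proof -
  have *: "std_normal_density z * (f (z + y) * p z) =
      f (y + 1 * z) * (p (y + 1 * z - y) * std_normal_density (y + 1 * z - y))" for z
    by (simp add: ac_simps)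
  have 1: "(\<integral>z. f (z + y) * p z \<partial>gauss) = (\<integral>z. std_normal_density z * (f (z + y) * p z) \<partial>lborel)"
    by (rule integral_gauss) measurable
  have 2: "integrable gauss (\<lambda>z. f (z + y) * p z) \<longleftrightarrow> integrable lborel (\<lambda>z. std_normal_density z * (f (z + y) * p z))"
    by (rule integrable_gauss_iff) measurable
  show "(\<integral>z. f (z + y) * p z \<partial>gauss) = (\<integral>z. f z * (p (z - y) * std_normal_density (z - y)) \<partial>lborel)"
    unfolding 1 * by (subst (2) lborel_integral_real_affine[of 1 _ y]) simp_all
  show "integrable gauss (\<lambda>z. f (z + y) * p z) \<longleftrightarrow>
      integrable lborel (\<lambda>z. f z * (p (z - y) * std_normal_density (z - y)))"
    unfolding 2 * by (rule lborel_integrable_real_affine_iff) simp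
qed

subsection \<open>Taylor expansion of Gaussian convolutions\<close>

lemma lipschitz_abs:
  assumes "L-lipschitz_on UNIV (h :: real \<Rightarrow> real)"
  shows "L-lipschitz_on UNIV (\<lambda>x. \<bar>h x\<bar>)"
proof (rule lipschitz_onI)
  show "0 \<le> L" using lipschitz_on_nonneg[OF assms] .
  fix x y :: real
  show "dist \<bar>h x\<bar> \<bar>h y\<bar> \<le> L * dist x y"
    using lipschitz_abs_le[OF assms, of x y] abs_triangle_ineq3[of "h x" "h y"]
    by (simp add: dist_real_def)
qed

lemma abs_hermite2_le: "\<bar>z\<^sup>2 - 1\<bar> \<le> 1 + z\<^sup>2" for z :: real
  by (simp add: abs_le_iff)

lemma integral_gauss_abs_hermite2_le: "(\<integral>z. \<bar>z\<^sup>2 - 1\<bar> \<partial>gauss) \<le> 2"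
proof -
  have "(\<integral>z. \<bar>z\<^sup>2 - 1\<bar> \<partial>gauss) \<le> (\<integral>z. 1 + z\<^sup>2 \<partial>gauss)"
    by (intro integral_mono abs_hermite2_le) auto
  then show ?thesis by simp
qed

lemma abs_le_one_plus_square: "\<bar>z\<bar> \<le> 1 + z\<^sup>2" for z :: real
  using abs_le_half_square[of z] zero_le_power2[of z] by argo

text \<open>The weight is the Taylor factor \<open>1 - \<theta>\<close> times a factor
  \<open>\<theta>\<close> from the Lipschitz bound on the second derivative. Together with the
  constant \<open>2\<close> of that bound, \<open>1 / 6\<close> gives the \<open>1 / 3\<close> in
  the remainder below.\<close>

lemma integral_triangle_weight:
  "(\<integral>\<theta>. indicator {0..1} \<theta> * ((1 - \<theta>) * \<theta>) \<partial>lborel) = (1 / 6 :: real)"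
  "integrable lborel (\<lambda>\<theta>. indicator {0..1} \<theta> * ((1 - \<theta>) * \<theta>) :: real)"
proof -
  have "(\<integral>\<theta>. ((1 - \<theta>) * \<theta>) * indicator {0..1} \<theta> \<partial>lborel) =
      (\<lambda>\<theta>. \<theta>\<^sup>2 / 2 - \<theta> ^ 3 / 3) 1 - (\<lambda>\<theta>. \<theta>\<^sup>2 / 2 - \<theta> ^ 3 / 3) (0::real)"
    by (rule integral_FTC_Icc_real)
      (auto intro!: derivative_eq_intros simp: field_simps power2_eq_square)
  then show "(\<integral>\<theta>. indicator {0..1} \<theta> * ((1 - \<theta>) * \<theta>) \<partial>lborel) = (1 / 6 :: real)"
    by (simp add: mult.commute)
  have "set_integrable lborel {0..1} (\<lambda>\<theta>. (1 - \<theta>) * \<theta> :: real)"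
    by (intro borel_integrable_atLeastAtMost' continuous_intros)
  then show "integrable lborel (\<lambda>\<theta>. indicator {0..1} \<theta> * ((1 - \<theta>) * \<theta>) :: real)"
    by (simp add: set_integrable_def)
qed

text \<open>The expansion is that of the density. Multiplying
  \<open>std_normal_density_taylor\<close> by \<open>f z\<close> and exchanging the integrals turns
  the remainder into a weighted integral of \<open>q \<theta> - q 0\<close>, which is at most
  \<open>2 * L * \<bar>y\<bar> * \<theta>\<close>.\<close>

lemma gauss_convolution_taylor:
  assumes f: "L-lipschitz_on UNIV (f :: real \<Rightarrow> real)"
  shows "\<bar>(\<integral>z. f (y + z) \<partial>gauss) - (\<integral>z. f z \<partial>gauss) - y * (\<integral>z. f z * z \<partial>gauss)
      - y\<^sup>2 / 2 * (\<integral>z. f z * (z\<^sup>2 - 1) \<partial>gauss)\<bar> \<le> L * \<bar>y\<bar> ^ 3 / 3"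
proof -
  note [measurable] = lipschitz_measurable[OF f]
  have L: "0 \<le> L" using lipschitz_on_nonneg[OF f] .
  define k where "k v = (v\<^sup>2 - 1) * std_normal_density v" for v
  have [measurable]: "k \<in> borel_measurable borel" unfolding k_def by measurable
  \<comment> \<open>\<open>q \<theta>\<close> is the second derivative of the Gaussian convolution
    of \<open>f\<close>, taken at \<open>\<theta> * y\<close>.\<close>
  define q where "q \<theta> = (\<integral>z. f (z + \<theta> * y) * (z\<^sup>2 - 1) \<partial>gauss)" for \<theta>
  have int: "integrable gauss (\<lambda>z. f (z + v) * p z)"
    if "p \<in> borel_measurable borel" "\<And>z. \<bar>p z\<bar> \<le> 1 + z\<^sup>2" for p v
    using integrable_gauss_lipschitz[OF f that, of v 1] by (simp add: add.commute)
  have shift: "(\<integral>z. f (z + v) * p z \<partial>gauss) = (\<integral>z. f z * (p (z - v) * std_normal_density (z - v)) \<partial>lborel)"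
    "integrable lborel (\<lambda>z. f z * (p (z - v) * std_normal_density (z - v)))"
    if "p \<in> borel_measurable borel" "\<And>z. \<bar>p z\<bar> \<le> 1 + z\<^sup>2" for p v
    using integral_gauss_shift[OF lipschitz_measurable[OF f] that(1), of v] int[OF that, of v] by auto
  have q: "q \<theta> = (\<integral>z. f z * k (z - \<theta> * y) \<partial>lborel)"
    and qi: "integrable lborel (\<lambda>z. f z * k (z - \<theta> * y))" for \<theta>
    unfolding q_def k_def using abs_hermite2_le by (rule shift[rotated]; measurable)+
  have i0: "(\<integral>z. f (y + z) \<partial>gauss) = (\<integral>z. f z * std_normal_density (z - y) \<partial>lborel)"
    "integrable lborel (\<lambda>z. f z * std_normal_density (z - y))" for y
    unfolding add.commute[of y] using shift[of "\<lambda>z. 1" y] by simp_all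
  have i1: "(\<integral>z. f z * z \<partial>gauss) = (\<integral>z. f z * (z * std_normal_density z) \<partial>lborel)"
    "integrable lborel (\<lambda>z. f z * (z * std_normal_density z))"
    using shift[of "\<lambda>z. z" 0] abs_le_one_plus_square by simp_all
  have i2: "(\<integral>z. f z * (z\<^sup>2 - 1) \<partial>gauss) = (\<integral>z. f z * k z \<partial>lborel)"
    "integrable lborel (\<lambda>z. f z * k z)"
    using q[of 0] qi[of 0] by (simp_all add: q_def)
  \<comment> \<open>\<open>g\<close> is integrated in both orders: over \<open>z\<close> it yields
    the increment of \<open>q\<close>, over \<open>\<theta>\<close> the Taylor remainder of the
    density, up to the factor \<open>y\<^sup>2\<close>.\<close>
  define g where "g \<theta> z = indicator {0..1} \<theta> * ((1 - \<theta>) * (f z * (k (z - \<theta> * y) - k z)))" for \<theta> z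
  have [measurable]: "(\<lambda>(\<theta>, z). g \<theta> z) \<in> borel_measurable (borel \<Otimes>\<^sub>M borel)"
    unfolding g_def by measurable
  have gz: "(\<integral>z. g \<theta> z \<partial>lborel) = indicator {0..1} \<theta> * ((1 - \<theta>) * (q \<theta> - q 0))" for \<theta>
  proof -
    have "(\<integral>z. g \<theta> z \<partial>lborel) = (\<integral>z. indicator {0..1} \<theta> * ((1 - \<theta>) * (f z * k (z - \<theta> * y) - f z * k z)) \<partial>lborel)"
      by (simp add: g_def right_diff_distrib)
    also have "\<dots> = indicator {0..1} \<theta> * ((1 - \<theta>) * (q \<theta> - q 0))"
      using qi[of \<theta>] i2 by (simp add: q[of \<theta>] q[of 0])
    finally show ?thesis .
  qed
  have g\<theta>: "(\<integral>\<theta>. g \<theta> z \<partial>lborel) * y\<^sup>2 = f z * (std_normal_density (z - y) - std_normal_density z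
      - y * z * std_normal_density z - y\<^sup>2 / 2 * k z)" for z
  proof -
    have "(\<integral>\<theta>. g \<theta> z \<partial>lborel) = (\<integral>\<theta>. f z * (indicator {0..1} \<theta> * ((1 - \<theta>) * (k (z - \<theta> * y) - k z))) \<partial>lborel)"
      by (simp add: g_def ac_simps)
    also have "\<dots> = f z * (\<integral>\<theta>. indicator {0..1} \<theta> * ((1 - \<theta>) * (k (z - \<theta> * y) - k z)) \<partial>lborel)"
      by (rule integral_mult_right_zero)
    finally show ?thesis
      using std_normal_density_taylor[of z y] by (simp add: k_def)
  qed
  have "integrable (lborel \<Otimes>\<^sub>M lborel) (\<lambda>(\<theta>, z). g \<theta> z)"
  proof (rule lborel_pair.Fubini_integrable)
    have gi: "integrable lborel (g \<theta>)" for \<theta>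
      using qi[of \<theta>] i2 unfolding g_def right_diff_distrib by (intro integrable_mult_right Bochner_Integration.integrable_diff)
    then show "AE \<theta> in lborel. integrable lborel (\<lambda>z. case (\<theta>, z) of (\<theta>, z) \<Rightarrow> g \<theta> z)" by simp
    \<comment> \<open>Absolute integrability for Fubini: \<open>A\<close> is the analogue of
      \<open>q\<close> for the Lipschitz function \<open>\<bar>f\<bar>\<close> and the weight
      \<open>\<bar>z\<^sup>2 - 1\<bar>\<close>, hence bounded on the unit interval; \<open>C\<close>
      bounds \<open>A \<theta> + A 0\<close>.\<close>
    define A where "A \<theta> = (\<integral>z. \<bar>f z\<bar> * \<bar>k (z - \<theta> * y)\<bar> \<partial>lborel)" for \<theta>
    define C where "C = (A 0 + L * \<bar>y\<bar> * 2) + A 0"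
    have f': "L-lipschitz_on UNIV (\<lambda>x. \<bar>f x\<bar>)" using f by (rule lipschitz_abs)
    have A: "A \<theta> = (\<integral>z. \<bar>f (\<theta> * y + 1 * z)\<bar> * \<bar>z\<^sup>2 - 1\<bar> \<partial>gauss)" for \<theta>
      using integral_gauss_shift[of "\<lambda>z. \<bar>f z\<bar>" "\<lambda>z. \<bar>z\<^sup>2 - 1\<bar>" "\<theta> * y"]
      by (simp add: A_def k_def abs_mult add.commute)
    have Ale: "A \<theta> \<le> A 0 + L * \<bar>y\<bar> * 2" if "\<theta> \<in> {0..1}" for \<theta>
    proof -
      have "A \<theta> - A 0 \<le> L * \<bar>\<theta> * y - 0 * y\<bar> * (\<integral>z. \<bar>\<bar>z\<^sup>2 - 1\<bar>\<bar> \<partial>gauss)"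
        using integral_gauss_lipschitz_diff[OF f', of "\<lambda>z. \<bar>z\<^sup>2 - 1\<bar>" "\<theta> * y" 1 "0 * y"] abs_hermite2_le
        unfolding A by simp
      also have "\<dots> \<le> L * \<bar>y\<bar> * 2"
        using L that integral_gauss_abs_hermite2_le
        by (intro mult_mono) (auto simp: abs_mult intro: mult_left_le_one_le)
      finally show ?thesis by simp
    qed
    have le: "\<bar>\<integral>z. \<bar>g \<theta> z\<bar> \<partial>lborel\<bar> \<le> C * indicator {0..1} \<theta>" for \<theta>
    proof (cases "\<theta> \<in> {0..1}")
      case True
      have "(\<integral>z. \<bar>g \<theta> z\<bar> \<partial>lborel) \<le> (\<integral>z. \<bar>f z\<bar> * \<bar>k (z - \<theta> * y)\<bar> + \<bar>f z\<bar> * \<bar>k (z - 0 * y)\<bar> \<partial>lborel)"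
      proof (rule integral_mono)
        show "integrable lborel (\<lambda>z. \<bar>f z\<bar> * \<bar>k (z - \<theta> * y)\<bar> + \<bar>f z\<bar> * \<bar>k (z - 0 * y)\<bar>)"
          using qi[of \<theta>] qi[of 0] by (intro Bochner_Integration.integrable_add) (simp_all flip: abs_mult)
        fix z
        have "\<bar>g \<theta> z\<bar> = (1 - \<theta>) * (\<bar>f z\<bar> * \<bar>k (z - \<theta> * y) - k z\<bar>)"
          using True by (simp add: g_def abs_mult)
        also have "\<dots> \<le> 1 * (\<bar>f z\<bar> * (\<bar>k (z - \<theta> * y)\<bar> + \<bar>k z\<bar>))"
          using True by (intro mult_mono abs_triangle_ineq4) auto
        finally show "\<bar>g \<theta> z\<bar> \<le> \<bar>f z\<bar> * \<bar>k (z - \<theta> * y)\<bar> + \<bar>f z\<bar> * \<bar>k (z - 0 * y)\<bar>"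
          by (simp add: distrib_left)
      qed (use gi in simp)
      also have "\<dots> = A \<theta> + A 0"
        using qi[of \<theta>] qi[of 0] unfolding A_def
        by (intro Bochner_Integration.integral_add) (simp_all flip: abs_mult)
      also have "\<dots> \<le> C" using Ale[OF True] by (simp add: C_def)
      finally show ?thesis using True by simp
    qed (simp add: g_def)
    show "integrable lborel (\<lambda>\<theta>. \<integral>z. norm (case (\<theta>, z) of (\<theta>, z) \<Rightarrow> g \<theta> z) \<partial>lborel)"
    proof (rule Bochner_Integration.integrable_bound)
      show "integrable lborel (\<lambda>\<theta>. C * indicator {0..1::real} \<theta>)" by simp
      show "AE \<theta> in lborel. norm (\<integral>z. norm (case (\<theta>, z) of (\<theta>, z) \<Rightarrow> g \<theta> z) \<partial>lborel) \<le> norm (C * indicator {0..1} \<theta>)"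
        using le by (intro AE_I2) (simp, metis abs_ge_self order_trans)
    qed measurable
  qed measurable
  then have "(\<integral>z. (\<integral>\<theta>. g \<theta> z \<partial>lborel) \<partial>lborel) = (\<integral>\<theta>. (\<integral>z. g \<theta> z \<partial>lborel) \<partial>lborel)"
    and int\<theta>: "integrable lborel (\<lambda>\<theta>. \<integral>z. g \<theta> z \<partial>lborel)"
    by (rule lborel_pair.Fubini_integral, rule lborel_pair.integrable_fst)
  note fub = this(1)
  have "(\<integral>z. f (y + z) \<partial>gauss) - (\<integral>z. f z \<partial>gauss) - y * (\<integral>z. f z * z \<partial>gauss)
      - y\<^sup>2 / 2 * (\<integral>z. f z * (z\<^sup>2 - 1) \<partial>gauss)
    = (\<integral>z. f z * std_normal_density (z - y) - f z * std_normal_density z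
        - y * (f z * (z * std_normal_density z)) - y\<^sup>2 / 2 * (f z * k z) \<partial>lborel)"
    using i0[of y] i0[of 0] i1 i2 by simp
  also have "\<dots> = (\<integral>z. (\<integral>\<theta>. g \<theta> z \<partial>lborel) * y\<^sup>2 \<partial>lborel)"
    unfolding g\<theta> by (rule arg_cong[where f="integral\<^sup>L lborel"]) (auto simp: algebra_simps)
  also have "\<dots> = (\<integral>\<theta>. indicator {0..1} \<theta> * ((1 - \<theta>) * (q \<theta> - q 0)) \<partial>lborel) * y\<^sup>2"
    by (simp add: fub gz)
  finally have eq: "(\<integral>z. f (y + z) \<partial>gauss) - (\<integral>z. f z \<partial>gauss) - y * (\<integral>z. f z * z \<partial>gauss)
      - y\<^sup>2 / 2 * (\<integral>z. f z * (z\<^sup>2 - 1) \<partial>gauss) =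
      (\<integral>\<theta>. indicator {0..1} \<theta> * ((1 - \<theta>) * (q \<theta> - q 0)) \<partial>lborel) * y\<^sup>2" .
  have "\<bar>\<integral>\<theta>. indicator {0..1} \<theta> * ((1 - \<theta>) * (q \<theta> - q 0)) \<partial>lborel\<bar>
      \<le> (\<integral>\<theta>. \<bar>indicator {0..1} \<theta> * ((1 - \<theta>) * (q \<theta> - q 0))\<bar> \<partial>lborel)"
    by (rule integral_abs_bound)
  also have "\<dots> \<le> (\<integral>\<theta>. 2 * L * \<bar>y\<bar> * (indicator {0..1} \<theta> * ((1 - \<theta>) * \<theta>)) \<partial>lborel)"
  proof (rule integral_mono)
    show "integrable lborel (\<lambda>\<theta>. \<bar>indicator {0..1} \<theta> * ((1 - \<theta>) * (q \<theta> - q 0))\<bar>)"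
      using int\<theta> by (simp add: gz)
    show "integrable lborel (\<lambda>\<theta>. 2 * L * \<bar>y\<bar> * (indicator {0..1} \<theta> * ((1 - \<theta>) * \<theta>)))"
      by (intro integrable_mult_right integral_triangle_weight)
    fix \<theta> :: real
    show "\<bar>indicator {0..1} \<theta> * ((1 - \<theta>) * (q \<theta> - q 0))\<bar> \<le> 2 * L * \<bar>y\<bar> * (indicator {0..1} \<theta> * ((1 - \<theta>) * \<theta>))"
    proof (cases "\<theta> \<in> {0..1}")
      case True
      have "\<bar>q \<theta> - q 0\<bar> \<le> L * \<bar>\<theta> * y - 0 * y\<bar> * (\<integral>z. \<bar>z\<^sup>2 - 1\<bar> \<partial>gauss)"
        using integral_gauss_lipschitz_diff[OF f, of "\<lambda>z. z\<^sup>2 - 1" "\<theta> * y" 1 "0 * y"] abs_hermite2_le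
        unfolding q_def by (simp add: add.commute)
      also have "\<dots> \<le> L * (\<theta> * \<bar>y\<bar>) * 2"
        using L True integral_gauss_abs_hermite2_le
        by (intro mult_mono) (auto simp: abs_mult)
      finally have "(1 - \<theta>) * \<bar>q \<theta> - q 0\<bar> \<le> (1 - \<theta>) * (L * (\<theta> * \<bar>y\<bar>) * 2)"
        using True by (intro mult_left_mono) auto
      then show ?thesis using True by (simp add: abs_mult ac_simps)
    qed simp
  qed
  also have "\<dots> = 2 * L * \<bar>y\<bar> * (1 / 6)"
    by (simp only: integral_mult_right_zero integral_triangle_weight)
  finally show ?thesis
    unfolding eq abs_mult by (auto dest: mult_right_mono[of _ _ "y\<^sup>2"] simp: power3_eq_cube power2_eq_square)
qed

subsection \<open>The Gaussian smoothing semigroup\<close>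

definition gauss_smooth :: "(real \<Rightarrow> real) \<Rightarrow> real \<Rightarrow> real \<Rightarrow> real" where
  "gauss_smooth h t x = (\<integral>z. h (x + sqrt t * z) \<partial>gauss)"

text \<open>The spatial derivatives for \<open>t > 0\<close>, written as integrals against Hermite polynomials because
  \<open>h\<close> need not be differentiable.\<close>

definition gauss_smooth' :: "(real \<Rightarrow> real) \<Rightarrow> real \<Rightarrow> real \<Rightarrow> real" where
  "gauss_smooth' h t x = (\<integral>z. h (x + sqrt t * z) * z \<partial>gauss) / sqrt t"

definition gauss_smooth'' :: "(real \<Rightarrow> real) \<Rightarrow> real \<Rightarrow> real \<Rightarrow> real" where
  "gauss_smooth'' h t x = (\<integral>z. h (x + sqrt t * z) * (z\<^sup>2 - 1) \<partial>gauss) / t"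

lemma gauss_smooth_0 [simp]: "gauss_smooth h 0 x = h x"
  by (simp add: gauss_smooth_def)

lemma integrable_gauss_smooth:
  assumes "L-lipschitz_on UNIV (h :: real \<Rightarrow> real)"
  shows "integrable gauss (\<lambda>z. h (x + c * z))"
  using integrable_gauss_lipschitz[OF assms, of "\<lambda>z. 1" x c] by simp

lemma gauss_smooth_lipschitz:
  assumes "L-lipschitz_on UNIV h"
  shows "L-lipschitz_on UNIV (gauss_smooth h t)"
proof (rule lipschitz_onI)
  show "0 \<le> L" using lipschitz_on_nonneg[OF assms] .
  show "dist (gauss_smooth h t x) (gauss_smooth h t y) \<le> L * dist x y" for x y
    using integral_gauss_lipschitz_diff[OF assms, of "\<lambda>z. 1" x "sqrt t" y]
    by (simp add: gauss_smooth_def dist_real_def)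
qed

text \<open>Both times are coupled through the same Gaussian variable, whose first absolute moment
  is at most \<open>1\<close>.\<close>

lemma gauss_smooth_time_le:
  assumes h: "L-lipschitz_on UNIV h"
  shows "\<bar>gauss_smooth h t x - gauss_smooth h s x\<bar> \<le> L * \<bar>sqrt t - sqrt s\<bar>"
proof -
  have L: "0 \<le> L" using lipschitz_on_nonneg[OF h] .
  note int = integrable_gauss_smooth[OF h, of x]
  have "\<bar>gauss_smooth h t x - gauss_smooth h s x\<bar> = \<bar>\<integral>z. h (x + sqrt t * z) - h (x + sqrt s * z) \<partial>gauss\<bar>"
    unfolding gauss_smooth_def by (simp only: Bochner_Integration.integral_diff int)
  also have "\<dots> \<le> (\<integral>z. \<bar>h (x + sqrt t * z) - h (x + sqrt s * z)\<bar> \<partial>gauss)"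
    by (rule integral_abs_bound)
  also have "\<dots> \<le> (\<integral>z. L * \<bar>sqrt t - sqrt s\<bar> * \<bar>z\<bar> \<partial>gauss)"
  proof (rule integral_mono)
    show "integrable gauss (\<lambda>z. \<bar>h (x + sqrt t * z) - h (x + sqrt s * z)\<bar>)"
      by (intro integrable_abs Bochner_Integration.integrable_diff int)
    show "\<bar>h (x + sqrt t * z) - h (x + sqrt s * z)\<bar> \<le> L * \<bar>sqrt t - sqrt s\<bar> * \<bar>z\<bar>" for z
      using lipschitz_abs_le[OF h, of "x + sqrt t * z" "x + sqrt s * z"]
      by (simp add: abs_mult flip: left_diff_distrib)
  qed simp
  also have "\<dots> = L * \<bar>sqrt t - sqrt s\<bar> * (\<integral>z. \<bar>z\<bar> \<partial>gauss)" by (rule integral_mult_right_zero)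
  also have "\<dots> \<le> L * \<bar>sqrt t - sqrt s\<bar> * 1"
    using L by (intro mult_left_mono integral_gauss_abs_le) auto
  finally show ?thesis by simp
qed

text \<open>As \<open>p\<close> has mean zero, the constant \<open>h x\<close> can be subtracted,
  and the Lipschitz bound then gains a factor \<open>c * \<bar>z\<bar>\<close>. For
  \<open>c = sqrt t\<close> this cancels one \<open>sqrt t\<close> in the denominators of the
  derivatives.\<close>

lemma integral_gauss_centred_bound:
  assumes h: "L-lipschitz_on UNIV (h :: real \<Rightarrow> real)"
    and [measurable]: "p \<in> borel_measurable borel"
    and p: "\<And>z. \<bar>p z\<bar> \<le> 1 + z\<^sup>2"
    and p0: "(\<integral>z. p z \<partial>gauss) = 0"
    and pz: "\<And>z. \<bar>z\<bar> * \<bar>p z\<bar> \<le> q z" "integrable gauss q"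
    and c: "0 \<le> c"
  shows "\<bar>\<integral>z. h (x + c * z) * p z \<partial>gauss\<bar> \<le> L * c * (\<integral>z. q z \<partial>gauss)"
proof -
  have L: "0 \<le> L" using lipschitz_on_nonneg[OF h] .
  note int = integrable_gauss_lipschitz[OF h assms(2) p, of x]
  have "(\<integral>z. h (x + c * z) * p z \<partial>gauss) = (\<integral>z. h (x + c * z) * p z \<partial>gauss) - h x * (\<integral>z. p z \<partial>gauss)"
    by (simp only: p0)
  also have "\<dots> = (\<integral>z. h (x + c * z) * p z - h (x + 0 * z) * p z \<partial>gauss)"
    using int[of c] int[of 0] by (simp only: Bochner_Integration.integral_diff integral_mult_right_zero) simp
  finally have "\<bar>\<integral>z. h (x + c * z) * p z \<partial>gauss\<bar> \<le> (\<integral>z. \<bar>h (x + c * z) * p z - h (x + 0 * z) * p z\<bar> \<partial>gauss)"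
    by (simp only: integral_abs_bound)
  also have "\<dots> \<le> (\<integral>z. L * c * q z \<partial>gauss)"
  proof (rule integral_mono)
    show "integrable gauss (\<lambda>z. \<bar>h (x + c * z) * p z - h (x + 0 * z) * p z\<bar>)"
      by (intro integrable_abs Bochner_Integration.integrable_diff int)
    show "integrable gauss (\<lambda>z. L * c * q z)" by (intro integrable_mult_right pz)
    fix z
    have "\<bar>h (x + c * z) * p z - h (x + 0 * z) * p z\<bar> = \<bar>h (x + c * z) - h (x + 0 * z)\<bar> * \<bar>p z\<bar>"
      by (metis abs_mult left_diff_distrib)
    also have "\<dots> \<le> L * (c * \<bar>z\<bar>) * \<bar>p z\<bar>"
      using lipschitz_abs_le[OF h, of "x + c * z" "x + 0 * z"] c
      by (intro mult_right_mono) (simp_all add: abs_mult)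
    also have "\<dots> = L * c * (\<bar>z\<bar> * \<bar>p z\<bar>)" by simp
    also have "\<dots> \<le> L * c * q z" using L c by (intro mult_left_mono pz) auto
    finally show "\<bar>h (x + c * z) * p z - h (x + 0 * z) * p z\<bar> \<le> L * c * q z" .
  qed
  finally show ?thesis by simp
qed

lemma abs_gauss_smooth'_le:
  assumes h: "L-lipschitz_on UNIV h" and t: "0 < t"
  shows "\<bar>gauss_smooth' h t x\<bar> \<le> L"
proof -
  have "\<bar>\<integral>z. h (x + sqrt t * z) * z \<partial>gauss\<bar> \<le> L * sqrt t * (\<integral>z. z\<^sup>2 \<partial>gauss)"
    using t by (intro integral_gauss_centred_bound[OF h] abs_le_one_plus_square)
      (simp_all flip: power2_eq_square)
  then show ?thesis using t by (simp add: gauss_smooth'_def pos_divide_le_eq)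
qed

lemma abs_gauss_smooth''_le:
  assumes h: "L-lipschitz_on UNIV h" and t: "0 < t"
  shows "\<bar>gauss_smooth'' h t x\<bar> \<le> 3 * L / sqrt t"
proof -
  have L: "0 \<le> L" using lipschitz_on_nonneg[OF h] .
  have "\<bar>\<integral>z. h (x + sqrt t * z) * (z\<^sup>2 - 1) \<partial>gauss\<bar> \<le> L * sqrt t * (\<integral>z. \<bar>z\<bar> ^ 3 + \<bar>z\<bar> \<partial>gauss)"
  proof (intro integral_gauss_centred_bound[OF h] abs_hermite2_le)
    show "\<bar>z\<bar> * \<bar>z\<^sup>2 - 1\<bar> \<le> \<bar>z\<bar> ^ 3 + \<bar>z\<bar>" for z :: real
      using mult_left_mono[OF abs_hermite2_le[of z], of "\<bar>z\<bar>"]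
      by (simp add: power3_eq_cube power2_eq_square distrib_left)
  qed (use t in simp_all)
  \<comment> \<open>The \<open>3\<close> is \<open>2 + 1\<close>, from the third and first absolute
    moments.\<close>
  also have "\<dots> \<le> L * sqrt t * 3"
    using L t integral_gauss_abs_le integral_gauss_abs3_le by (intro mult_left_mono) simp_all
  finally have "\<bar>gauss_smooth'' h t x\<bar> \<le> L * sqrt t * 3 / t"
    using t by (simp add: gauss_smooth''_def divide_right_mono)
  also have "\<dots> = 3 * L / sqrt t"
    using t by (simp add: field_simps)
  finally show ?thesis .
qed

text \<open>This is \<open>gauss_convolution_taylor\<close> for the rescaled function
  \<open>h (x + c * z)\<close> with \<open>c = sqrt t\<close>: its Lipschitz constant is
  \<open>L * c\<close> and the displacement is \<open>y / c\<close>.\<close>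

lemma gauss_smooth_taylor:
  assumes h: "L-lipschitz_on UNIV h" and t: "0 < t"
  shows "\<bar>gauss_smooth h t (x + y) - gauss_smooth h t x - y * gauss_smooth' h t x
      - y\<^sup>2 / 2 * gauss_smooth'' h t x\<bar> \<le> L * \<bar>y\<bar> ^ 3 / (3 * t)"
proof -
  have L: "0 \<le> L" using lipschitz_on_nonneg[OF h] .
  define c where "c = sqrt t"
  have c: "0 < c" "t = c * c" using t by (simp_all add: c_def)
  have f: "(L * c)-lipschitz_on UNIV (\<lambda>z. h (x + c * z))"
  proof (rule lipschitz_onI)
    show "dist (h (x + c * z)) (h (x + c * w)) \<le> L * c * dist z w" for z w
      using lipschitz_abs_le[OF h, of "x + c * z" "x + c * w"] c
      by (simp add: dist_real_def abs_mult flip: right_diff_distrib)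
  qed (use L c in simp)
  have "(\<integral>z. h (x + c * (y / c + z)) \<partial>gauss) = gauss_smooth h t (x + y)"
    using c by (simp add: gauss_smooth_def c_def[symmetric] distrib_left add.assoc)
  moreover have "L * c * \<bar>y / c\<bar> ^ 3 / 3 = L * \<bar>y\<bar> ^ 3 / (3 * t)"
    using c by (simp add: power3_eq_cube field_simps)
  moreover have "y / c * (\<integral>z. h (x + c * z) * z \<partial>gauss) = y * gauss_smooth' h t x"
    by (simp add: gauss_smooth'_def c_def)
  moreover have "(y / c)\<^sup>2 / 2 * (\<integral>z. h (x + c * z) * (z\<^sup>2 - 1) \<partial>gauss) = y\<^sup>2 / 2 * gauss_smooth'' h t x"
    using c(1) unfolding gauss_smooth''_def c_def[symmetric] c(2) by (simp add: power2_eq_square)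
  ultimately show ?thesis
    using gauss_convolution_taylor[OF f, of "y / c"] by (simp add: gauss_smooth_def c_def)
qed

lemma distributed_scaled_gauss:
  assumes "prob_space M" and Z: "Z \<in> borel_measurable M" "distr M lborel Z = gauss" and "0 < s"
  shows "distributed M lborel (\<lambda>\<omega>. sqrt s * Z \<omega>) (normal_density 0 (sqrt s))"
proof -
  interpret prob_space M by fact
  have "distributed M lborel Z std_normal_density"
    using Z by (simp add: distributed_def)
  then show ?thesis
    using normal_density_affine[of Z 0 1 "sqrt s" 0] \<open>0 < s\<close> by simp
qed

text \<open>A sum of independent centred Gaussians with variances \<open>t\<close> and
  \<open>s\<close> is Gaussian with variance \<open>t + s\<close>. The coordinates of the product
  measure \<open>P\<close> realise the two variables, and Fubini separates them.\<close>

lemma gauss_smooth_semigroup: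
  assumes h: "L-lipschitz_on UNIV h" and t: "0 < t" "0 < s"
  shows "gauss_smooth h (t + s) x = (\<integral>w. gauss_smooth h t (x + sqrt s * w) \<partial>gauss)"
proof -
  note [measurable] = lipschitz_measurable[OF h]
  have L: "0 \<le> L" using lipschitz_on_nonneg[OF h] .
  interpret G: prob_space gauss by (rule prob_space_gauss)
  interpret GG: pair_prob_space gauss gauss ..
  define P where "P = gauss \<Otimes>\<^sub>M gauss"
  have P: "prob_space P" unfolding P_def by (rule GG.prob_space_axioms)
  interpret P: prob_space P by (rule P)
  have [measurable]: "fst \<in> borel_measurable P" "snd \<in> borel_measurable P"
    unfolding P_def by (simp_all cong: measurable_cong_sets)
  have fst': "distr P gauss fst = gauss"
    unfolding P_def by (rule G.distr_pair_fst)
  have "distr P gauss snd = distr (distr P P (\<lambda>(x, y). (y, x))) gauss snd"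
    unfolding P_def by (simp only: GG.distr_pair_swap[symmetric])
  also have "\<dots> = distr P gauss fst"
    unfolding P_def by (subst distr_distr) (auto simp: comp_def case_prod_beta intro!: distr_cong)
  finally have snd': "distr P gauss snd = gauss" by (simp only: fst')
  \<comment> \<open>\<open>distr\<close> depends on its target only through the measurable sets.
    Both forms occur below: \<open>distributed\<close> refers to \<open>lborel\<close>, independence
    to \<open>borel\<close>.\<close>
  have fst: "distr P lborel fst = gauss" "distr P borel fst = gauss"
    by (rule trans[OF distr_cong fst']; simp)+
  have snd: "distr P lborel snd = gauss" "distr P borel snd = gauss"
    by (rule trans[OF distr_cong snd']; simp)+
  have "P.indep_var borel fst borel snd"
    unfolding P.indep_var_distribution_eq fst snd
  proof (intro conjI)
    have "sets (borel \<Otimes>\<^sub>M borel) = sets P"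
      unfolding P_def by (intro sets_pair_measure_cong) simp_all
    then have "distr P (borel \<Otimes>\<^sub>M borel) (\<lambda>x. x) = P"
      by (rule distr_id2)
    then show "gauss \<Otimes>\<^sub>M gauss = distr P (borel \<Otimes>\<^sub>M borel) (\<lambda>x. (fst x, snd x))"
      unfolding prod.collapse by (simp only: P_def)
  qed measurable
  then have "P.indep_var borel ((\<lambda>z. sqrt t * z) \<circ> fst) borel ((\<lambda>z. sqrt s * z) \<circ> snd)"
    by (rule P.indep_var_compose) auto
  then have ind: "P.indep_var borel (\<lambda>p. sqrt t * fst p) borel (\<lambda>p. sqrt s * snd p)"
    by (simp add: comp_def)
  have sum: "distributed P lborel (\<lambda>p. sqrt t * fst p + sqrt s * snd p) (normal_density 0 (sqrt (t + s)))"
    using P.add_indep_normal[OF ind _ _ distributed_scaled_gauss[OF P _ fst(1)] distributed_scaled_gauss[OF P _ snd(1)]] t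
    by simp
  have one: "distributed gauss lborel (\<lambda>z. sqrt (t + s) * z) (normal_density 0 (sqrt (t + s)))"
    using t by (intro distributed_scaled_gauss prob_space_gauss) (auto intro!: distr_id2)
  have "gauss_smooth h (t + s) x = (\<integral>z. normal_density 0 (sqrt (t + s)) z * h (x + z) \<partial>lborel)"
    unfolding gauss_smooth_def by (rule distributed_integral[OF one, symmetric]) simp_all
  also have "\<dots> = (\<integral>p. h (x + (sqrt t * fst p + sqrt s * snd p)) \<partial>P)"
    by (rule distributed_integral[OF sum]) simp_all
  also have "\<dots> = (\<integral>w. (\<integral>z. h (x + (sqrt t * z + sqrt s * w)) \<partial>gauss) \<partial>gauss)"
  proof -
    have "integrable P (\<lambda>p. \<bar>h x\<bar> + L * (sqrt t * \<bar>fst p\<bar> + sqrt s * \<bar>snd p\<bar>))"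
    proof (intro Bochner_Integration.integrable_add integrable_mult_right)
      show "integrable P (\<lambda>p. \<bar>fst p\<bar>)"
        using integrable_distr_eq[of fst P borel "\<lambda>z. \<bar>z\<bar>"] by (simp add: fst)
      show "integrable P (\<lambda>p. \<bar>snd p\<bar>)"
        using integrable_distr_eq[of snd P borel "\<lambda>z. \<bar>z\<bar>"] by (simp add: snd)
    qed simp
    then have "integrable P (\<lambda>p. h (x + (sqrt t * fst p + sqrt s * snd p)))"
    proof (rule Bochner_Integration.integrable_bound)
      show "AE p in P. norm (h (x + (sqrt t * fst p + sqrt s * snd p)))
        \<le> norm (\<bar>h x\<bar> + L * (sqrt t * \<bar>fst p\<bar> + sqrt s * \<bar>snd p\<bar>))"
      proof (rule AE_I2)
        fix p :: "real \<times> real"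
        have "\<bar>h (x + (sqrt t * fst p + sqrt s * snd p)) - h x\<bar> \<le> L * \<bar>sqrt t * fst p + sqrt s * snd p\<bar>"
          using lipschitz_abs_le[OF h, of "x + (sqrt t * fst p + sqrt s * snd p)" x] by simp
        also have "\<dots> \<le> L * (sqrt t * \<bar>fst p\<bar> + sqrt s * \<bar>snd p\<bar>)"
          using t by (intro mult_left_mono L order_trans[OF abs_triangle_ineq]) (simp add: abs_mult)
        finally show "norm (h (x + (sqrt t * fst p + sqrt s * snd p)))
          \<le> norm (\<bar>h x\<bar> + L * (sqrt t * \<bar>fst p\<bar> + sqrt s * \<bar>snd p\<bar>))"
          unfolding real_norm_def by argo
      qed
    qed measurable
    then have "integrable (gauss \<Otimes>\<^sub>M gauss) (\<lambda>(z, w). h (x + (sqrt t * z + sqrt s * w)))"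
      by (simp only: P_def case_prod_unfold)
    then have "(\<integral>w. (\<integral>z. h (x + (sqrt t * z + sqrt s * w)) \<partial>gauss) \<partial>gauss)
        = (\<integral>(z, w). h (x + (sqrt t * z + sqrt s * w)) \<partial>(gauss \<Otimes>\<^sub>M gauss))"
      by (rule GG.integral_snd)
    then show ?thesis
      by (simp only: P_def case_prod_unfold)
  qed
  also have "\<dots> = (\<integral>w. gauss_smooth h t (x + sqrt s * w) \<partial>gauss)"
    by (simp add: gauss_smooth_def ac_simps)
  finally show ?thesis .
qed

subsection \<open>One replacement step\<close>

text \<open>By the semigroup law, additional time \<open>s\<^sup>2\<close> is an average over
  Gaussian displacements \<open>s * w\<close>. In the spatial expansion the linear term averages to
  zero, the quadratic one to \<open>s\<^sup>2 / 2\<close>, and the cubic remainder acquires the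
  factor \<open>2\<close>.\<close>

lemma gauss_smooth_time_taylor:
  assumes h: "L-lipschitz_on UNIV h" and t: "0 < t" "0 < s"
  shows "\<bar>gauss_smooth h (t + s\<^sup>2) x - gauss_smooth h t x - s\<^sup>2 / 2 * gauss_smooth'' h t x\<bar>
    \<le> 2 * L * s ^ 3 / (3 * t)"
proof -
  have L: "0 \<le> L" using lipschitz_on_nonneg[OF h] .
  define r where "r w = gauss_smooth h t (x + s * w) - gauss_smooth h t x
    - s * w * gauss_smooth' h t x - (s * w)\<^sup>2 / 2 * gauss_smooth'' h t x" for w
  have int: "integrable gauss (\<lambda>w. gauss_smooth h t (x + s * w))"
    by (rule integrable_gauss_smooth[OF gauss_smooth_lipschitz[OF h]])
  have int2: "integrable gauss (\<lambda>w. (s * w)\<^sup>2 / 2 * gauss_smooth'' h t x)"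
    by (simp add: power_mult_distrib)
  have intr: "integrable gauss r"
    unfolding r_def using int int2 by simp
  have "gauss_smooth h (t + s\<^sup>2) x = (\<integral>w. gauss_smooth h t (x + s * w) \<partial>gauss)"
    using gauss_smooth_semigroup[OF h t(1), of "s\<^sup>2" x] t by simp
  then have "gauss_smooth h (t + s\<^sup>2) x - gauss_smooth h t x - s\<^sup>2 / 2 * gauss_smooth'' h t x = (\<integral>w. r w \<partial>gauss)"
    unfolding r_def using int int2 by (simp add: power_mult_distrib)
  then have "\<bar>gauss_smooth h (t + s\<^sup>2) x - gauss_smooth h t x - s\<^sup>2 / 2 * gauss_smooth'' h t x\<bar>
      \<le> (\<integral>w. \<bar>r w\<bar> \<partial>gauss)"
    by (simp only: integral_abs_bound)
  also have "\<dots> \<le> (\<integral>w. L * s ^ 3 / (3 * t) * \<bar>w\<bar> ^ 3 \<partial>gauss)"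
  proof (rule integral_mono)
    show "\<bar>r w\<bar> \<le> L * s ^ 3 / (3 * t) * \<bar>w\<bar> ^ 3" for w
      using gauss_smooth_taylor[OF h t(1), of x "s * w"] t
      by (simp add: r_def abs_mult power_mult_distrib)
  qed (use intr in simp_all)
  also have "\<dots> = L * s ^ 3 / (3 * t) * (\<integral>w. \<bar>w\<bar> ^ 3 \<partial>gauss)" by (rule integral_mult_right_zero)
  also have "\<dots> \<le> L * s ^ 3 / (3 * t) * 2"
    using L t by (intro mult_left_mono integral_gauss_abs3_le) simp
  finally show ?thesis by (simp add: ac_simps)
qed

text \<open>\<open>v\<close> stands for the conditional variance of the increment. The threshold
  \<open>2 * t = v\<close> separates the Lipschitz regime, without linear term, from the Taylor
  regime.\<close>

definition drift_coeff :: "(real \<Rightarrow> real) \<Rightarrow> real \<Rightarrow> real \<Rightarrow> real \<Rightarrow> real" where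
  "drift_coeff h t v x = (if 2 * t \<le> v then 0 else gauss_smooth' h t x)"

definition variance_coeff :: "(real \<Rightarrow> real) \<Rightarrow> real \<Rightarrow> real \<Rightarrow> real \<Rightarrow> real" where
  "variance_coeff h t v x =
    (if 2 * t \<le> v then - 5 / (2 * sqrt v) else gauss_smooth'' h t x / 2 - sqrt v / t)"

lemma abs_drift_coeff_le:
  assumes "1-lipschitz_on UNIV h" "0 \<le> t" "0 < v"
  shows "\<bar>drift_coeff h t v x\<bar> \<le> 1"
  using abs_gauss_smooth'_le[OF assms(1), of t x] assms by (auto simp: drift_coeff_def)

text \<open>The coefficient may blow up as \<open>v\<close> tends to zero, but \<open>v\<close>
  times it stays of order \<open>sqrt v\<close>, which keeps it integrable. In the Taylor regime
  \<open>5\<close> is \<open>3 + 2\<close>, one summand for each term of the coefficient.\<close>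

lemma abs_variance_coeff_le:
  assumes h: "1-lipschitz_on UNIV h" and "0 \<le> t" and v: "0 < v"
  shows "\<bar>variance_coeff h t v x\<bar> \<le> 5 / sqrt v"
proof (cases "2 * t \<le> v")
  case True
  then show ?thesis using \<open>0 < v\<close> by (simp add: variance_coeff_def field_simps)
next
  case False
  define s where "s = sqrt v"
  define u where "u = sqrt t"
  have su: "0 < s" "0 < u" "v = s\<^sup>2" "t = u\<^sup>2"
    using False assms by (auto simp: s_def u_def)
  \<comment> \<open>The available factor \<open>2\<close> is weakened to \<open>4\<close>, a perfect
    square, so that roots can be taken.\<close>
  have "s\<^sup>2 \<le> 4 * u\<^sup>2" using False su zero_le_power2[of u] by argo
  then have "s\<^sup>2 \<le> (2 * u)\<^sup>2" by (simp add: power_mult_distrib)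
  then have "s \<le> 2 * u" using su by (metis abs_le_square_iff abs_of_pos mult_pos_pos zero_less_numeral)
  have "\<bar>variance_coeff h t v x\<bar> \<le> \<bar>gauss_smooth'' h t x\<bar> / 2 + s / t"
  proof -
    have "variance_coeff h t v x = gauss_smooth'' h t x / 2 - s / t"
      using False by (simp add: variance_coeff_def s_def)
    moreover have "\<bar>s / t\<bar> = s / t" using su(1) \<open>0 \<le> t\<close> by simp
    moreover have "\<bar>gauss_smooth'' h t x / 2\<bar> = \<bar>gauss_smooth'' h t x\<bar> / 2" by simp
    ultimately show ?thesis
      using abs_triangle_ineq4[of "gauss_smooth'' h t x / 2" "s / t"] by argo
  qed
  also have "\<dots> \<le> 3 / u / 2 + s / t"
    using abs_gauss_smooth''_le[OF h, of t x] False v by (simp add: u_def)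
  also have "\<dots> \<le> 3 / s + 2 / s"
  proof (rule add_mono)
    show "3 / u / 2 \<le> 3 / s" using \<open>s \<le> 2 * u\<close> su by (simp add: field_simps)
    show "s / t \<le> 2 / s" using False su by (simp add: field_simps power2_eq_square)
  qed
  finally show ?thesis by (simp add: s_def)
qed

text \<open>For \<open>t \<le> v / 2\<close> the Lipschitz bound suffices; the coefficient \<open>5 / (2 s)\<close> is the one for
  which \<open>2 r\<^sup>3 / s\<^sup>2 - r - s - 5 / (2 s) (r\<^sup>2 - s\<^sup>2)\<close> has a double root at \<open>r = s\<close>. Otherwise both
  smoothings are expanded around time \<open>t\<close>.\<close>

lemma lindeberg_step_bound:
  assumes h: "1-lipschitz_on UNIV h" and t: "0 \<le> t" and v: "0 < v"
  shows "gauss_smooth h t (x + y) - gauss_smooth h (t + v) x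
    \<le> 3 * \<bar>y\<bar> ^ 3 / (t + v) + drift_coeff h t v x * y + variance_coeff h t v x * (y\<^sup>2 - v)"
proof -
  define s where "s = sqrt v"
  define r where "r = \<bar>y\<bar>"
  have s: "0 < s" "v = s\<^sup>2" using v by (simp_all add: s_def)
  have r: "0 \<le> r" "y\<^sup>2 = r\<^sup>2" by (simp_all add: r_def)
  show ?thesis
  proof (cases "2 * t \<le> v")
    case True
    have "gauss_smooth h t (x + y) - gauss_smooth h (t + v) x
        = (gauss_smooth h t (x + y) - gauss_smooth h t x) + (gauss_smooth h t x - gauss_smooth h (t + v) x)"
      by simp
    also have "\<dots> \<le> r + (sqrt (t + v) - sqrt t)"
      using lipschitz_abs_le[OF gauss_smooth_lipschitz[OF h], of t "x + y" x]
        gauss_smooth_time_le[OF h, of t x "t + v"] v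
      by (intro add_mono) (simp_all add: r_def abs_le_iff)
    also have "sqrt (t + v) - sqrt t \<le> s"
      using sqrt_add_le_add_sqrt[of t v] t v by (simp add: s_def)
    also have "r + s \<le> 2 * r ^ 3 / s\<^sup>2 - 5 / (2 * s) * (r\<^sup>2 - s\<^sup>2)"
    proof -
      have "0 \<le> (r - s)\<^sup>2 * (2 * r + 3 / 2 * s) / s\<^sup>2"
        using s r by simp
      also have "\<dots> = 2 * r ^ 3 / s\<^sup>2 - 5 / (2 * s) * (r\<^sup>2 - s\<^sup>2) - (r + s)"
        using s by (simp add: field_simps power2_eq_square power3_eq_cube)
      finally show ?thesis by simp
    qed
    \<comment> \<open>Here \<open>t \<le> v / 2\<close> gives \<open>t + v \<le> 3 * v / 2\<close>,
      while in the other case \<open>v < 2 * t\<close> gives \<open>t + v < 3 * t\<close>. The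
      threshold thus produces the constant \<open>3\<close> in both regimes.\<close>
    also have "2 * r ^ 3 / s\<^sup>2 \<le> 3 * r ^ 3 / (t + v)"
    proof -
      have "r ^ 3 * (2 * (t + v)) \<le> r ^ 3 * (3 * v)"
        using True r by (intro mult_left_mono) auto
      then show ?thesis using t v by (simp add: s(2)[symmetric] field_simps)
    qed
    finally show ?thesis
      using True by (simp add: drift_coeff_def variance_coeff_def s_def[symmetric] r(2) s(2)[symmetric] r_def[symmetric])
  next
    case False
    then have t': "0 < t" using v t by auto
    let ?D1 = "gauss_smooth' h t x" and ?D2 = "gauss_smooth'' h t x"
    have "gauss_smooth h t (x + y) - gauss_smooth h t x - y * ?D1 - r\<^sup>2 / 2 * ?D2 \<le> r ^ 3 / (3 * t)"
      using gauss_smooth_taylor[OF h t', of x y] by (simp add: r_def abs_le_iff)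
    moreover have "- (gauss_smooth h (t + v) x - gauss_smooth h t x - v / 2 * ?D2) \<le> 2 * s ^ 3 / (3 * t)"
      using gauss_smooth_time_taylor[OF h t' s(1), of x] unfolding s(2) abs_le_iff by simp
    moreover have "(r ^ 3 + 2 * s ^ 3) / (3 * t) = r ^ 3 / (3 * t) + 2 * s ^ 3 / (3 * t)"
      by (rule add_divide_distrib)
    moreover have "(r\<^sup>2 - v) * (?D2 / 2) = r\<^sup>2 / 2 * ?D2 - v / 2 * ?D2"
      by (simp add: left_diff_distrib diff_divide_distrib)
    ultimately have "gauss_smooth h t (x + y) - gauss_smooth h (t + v) x
        \<le> (r ^ 3 + 2 * s ^ 3) / (3 * t) + y * ?D1 + (r\<^sup>2 - v) * (?D2 / 2)"
      by argo
    also have "(r ^ 3 + 2 * s ^ 3) / (3 * t) \<le> r ^ 3 / t - (r\<^sup>2 - v) * (s / t)"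
    proof -
      \<comment> \<open>The numerator is \<open>2 r\<^sup>3 - 3 r\<^sup>2 s + s\<^sup>3\<close>; the
        correction \<open>- sqrt v / t\<close> in \<open>variance_coeff\<close> is chosen to give it
        a double root at \<open>r = s\<close>.\<close>
      have "0 \<le> (r - s)\<^sup>2 * (2 * r + s) / (3 * t)"
        using s r t by simp
      also have "\<dots> = r ^ 3 / t - (r\<^sup>2 - v) * (s / t) - (r ^ 3 + 2 * s ^ 3) / (3 * t)"
        using t' s(2) by (simp add: field_simps power2_eq_square power3_eq_cube)
      finally show ?thesis by simp
    qed
    also have "r ^ 3 / t \<le> 3 * r ^ 3 / (t + v)"
    proof -
      have "r ^ 3 * (t + v) \<le> r ^ 3 * (3 * t)"
        using False r by (intro mult_left_mono) auto
      then show ?thesis using t' v by (simp add: field_simps)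
    qed
    finally show ?thesis
      using False by (simp add: drift_coeff_def variance_coeff_def s_def[symmetric] r(2) r_def[symmetric] algebra_simps)
  qed
qed

section \<open>Measurability and integrability at random times and positions\<close>

lemma borel_measurable_gauss_integral:
  fixes f :: "'a \<Rightarrow> real \<Rightarrow> real"
  assumes "(\<lambda>(\<omega>, z). f \<omega> z) \<in> borel_measurable (G \<Otimes>\<^sub>M borel)"
  shows "(\<lambda>\<omega>. \<integral>z. f \<omega> z \<partial>gauss) \<in> borel_measurable G"
proof -
  interpret prob_space gauss by (rule prob_space_gauss)
  have "sets (G \<Otimes>\<^sub>M gauss) = sets (G \<Otimes>\<^sub>M borel)" by (intro sets_pair_measure_cong) simp_all
  then have "(\<lambda>(\<omega>, z). f \<omega> z) \<in> borel_measurable (G \<Otimes>\<^sub>M gauss)"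
    using assms by (simp cong: measurable_cong_sets)
  then show ?thesis by (rule borel_measurable_lebesgue_integral)
qed

context
  fixes h :: "real \<Rightarrow> real" and G :: "'a measure" and t x v :: "'a \<Rightarrow> real"
  assumes [measurable]: "h \<in> borel_measurable borel" "t \<in> borel_measurable G"
    "x \<in> borel_measurable G" "v \<in> borel_measurable G"
begin

lemma borel_measurable_gauss_smooth [measurable]:
  "(\<lambda>\<omega>. gauss_smooth h (t \<omega>) (x \<omega>)) \<in> borel_measurable G"
  unfolding gauss_smooth_def by (rule borel_measurable_gauss_integral) measurable

lemma borel_measurable_drift_coeff:
  "(\<lambda>\<omega>. drift_coeff h (t \<omega>) (v \<omega>) (x \<omega>)) \<in> borel_measurable G"
proof -
  have [measurable]: "(\<lambda>\<omega>. gauss_smooth' h (t \<omega>) (x \<omega>)) \<in> borel_measurable G"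
    unfolding gauss_smooth'_def
    by (intro borel_measurable_divide borel_measurable_gauss_integral) measurable
  show ?thesis unfolding drift_coeff_def by measurable
qed

lemma borel_measurable_variance_coeff:
  "(\<lambda>\<omega>. variance_coeff h (t \<omega>) (v \<omega>) (x \<omega>)) \<in> borel_measurable G"
proof -
  have [measurable]: "(\<lambda>\<omega>. gauss_smooth'' h (t \<omega>) (x \<omega>)) \<in> borel_measurable G"
    unfolding gauss_smooth''_def
    by (intro borel_measurable_divide borel_measurable_gauss_integral) measurable
  show ?thesis unfolding variance_coeff_def by measurable
qed

end

lemma (in prob_space) integrable_gauss_smooth_comp:
  assumes h: "L-lipschitz_on UNIV h"
    and [measurable]: "t \<in> borel_measurable M"
    and x: "integrable M x" and t: "AE \<omega> in M. 0 \<le> t \<omega> \<and> t \<omega> \<le> C"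
  shows "integrable M (\<lambda>\<omega>. gauss_smooth h (t \<omega>) (x \<omega>))"
proof (rule Bochner_Integration.integrable_bound)
  note [measurable] = lipschitz_measurable[OF h] borel_measurable_integrable[OF x]
  have L: "0 \<le> L" using lipschitz_on_nonneg[OF h] .
  show "integrable M (\<lambda>\<omega>. \<bar>h 0\<bar> + L * \<bar>x \<omega>\<bar> + L * sqrt C)"
    using x by (intro Bochner_Integration.integrable_add integrable_mult_right integrable_abs) simp_all
  show "(\<lambda>\<omega>. gauss_smooth h (t \<omega>) (x \<omega>)) \<in> borel_measurable M" by measurable
  show "AE \<omega> in M. norm (gauss_smooth h (t \<omega>) (x \<omega>)) \<le> norm (\<bar>h 0\<bar> + L * \<bar>x \<omega>\<bar> + L * sqrt C)"
    using t
  proof eventually_elim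
    case (elim \<omega>)
    have "\<bar>gauss_smooth h (t \<omega>) (x \<omega>) - h (x \<omega>)\<bar> \<le> L * sqrt (t \<omega>)"
      using gauss_smooth_time_le[OF h, of "t \<omega>" "x \<omega>" 0] elim by simp
    also have "\<dots> \<le> L * sqrt C" using elim L by (intro mult_left_mono) simp_all
    finally have "\<bar>gauss_smooth h (t \<omega>) (x \<omega>) - h (x \<omega>)\<bar> \<le> L * sqrt C" .
    moreover have "\<bar>h (x \<omega>) - h 0\<bar> \<le> L * \<bar>x \<omega>\<bar>"
      using lipschitz_abs_le[OF h, of "x \<omega>" 0] by simp
    ultimately show ?case unfolding real_norm_def by argo
  qed
qed

section \<open>The replacement step in expectation\<close>

lemma ennreal_integral_le_nn_integral:
  assumes "integrable M (f :: 'a \<Rightarrow> real)"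
  shows "ennreal (\<integral>\<omega>. f \<omega> \<partial>M) \<le> (\<integral>\<^sup>+\<omega>. ennreal (f \<omega>) \<partial>M)"
proof -
  have i: "integrable M (\<lambda>\<omega>. max 0 (f \<omega>))" using assms by simp
  have "ennreal (\<integral>\<omega>. f \<omega> \<partial>M) \<le> ennreal (\<integral>\<omega>. max 0 (f \<omega>) \<partial>M)"
    using assms i by (intro ennreal_leI integral_mono) simp_all
  also have "\<dots> = (\<integral>\<^sup>+\<omega>. ennreal (max 0 (f \<omega>)) \<partial>M)"
    using i by (intro nn_integral_eq_integral[symmetric]) simp_all
  also have "\<dots> = (\<integral>\<^sup>+\<omega>. ennreal (f \<omega>) \<partial>M)"
    by (intro nn_integral_cong) (simp add: max_def ennreal_neg)
  finally show ?thesis .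
qed

text \<open>\<open>real_cond_exp\<close> is a difference of two nonnegative conditional
  expectations; here the first is finite and the second zero almost surely. The nonnegative version
  can be tested against a factor before the product is known to be integrable.\<close>

lemma (in sigma_finite_subalgebra) nn_cond_exp_eq_real_cond_exp:
  assumes f: "integrable M f" and pos: "\<And>\<omega>. 0 \<le> f \<omega>"
  shows "AE \<omega> in M. nn_cond_exp M F (\<lambda>\<omega>. ennreal (f \<omega>)) \<omega> = ennreal (real_cond_exp M F f \<omega>)"
proof -
  note [measurable] = borel_measurable_integrable[OF f]
  have "(\<integral>\<^sup>+\<omega>. nn_cond_exp M F (\<lambda>\<omega>. ennreal (f \<omega>)) \<omega> \<partial>M) = (\<integral>\<^sup>+\<omega>. ennreal (f \<omega>) \<partial>M)"
    using nn_cond_exp_intg[of "\<lambda>_. 1" "\<lambda>\<omega>. ennreal (f \<omega>)"] by simp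
  also have "\<dots> \<noteq> \<infinity>" using f pos by (simp add: nn_integral_eq_integral)
  finally have "AE \<omega> in M. nn_cond_exp M F (\<lambda>\<omega>. ennreal (f \<omega>)) \<omega> \<noteq> \<infinity>"
    by (intro nn_integral_noteq_infinite) simp_all
  moreover have "AE \<omega> in M. 0 = nn_cond_exp M F (\<lambda>\<omega>. 0) \<omega>"
    by (rule nn_cond_exp_F_meas) simp
  ultimately show ?thesis
  proof eventually_elim
    case (elim \<omega>)
    have "(\<lambda>\<omega>. ennreal (- f \<omega>)) = (\<lambda>\<omega>. 0)" using pos by (simp add: ennreal_neg)
    with elim show ?case by (simp add: real_cond_exp_def less_top)
  qed
qed

text \<open>\<open>lindeberg_step_bound\<close> is integrated at \<open>x = S\<close>,
  \<open>y = Y\<close>. Its coefficients are \<open>G\<close>-measurable, so the terms in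
  \<open>Y\<close> and in \<open>Y\<^sup>2 - v\<close> have mean zero and only the cubic term
  remains.\<close>

lemma (in prob_space) lindeberg_step:
  assumes h: "1-lipschitz_on UNIV h" and sub: "subalgebra M G"
    and S: "S \<in> borel_measurable G" "integrable M S"
    and t: "t \<in> borel_measurable G" "AE \<omega> in M. 0 \<le> t \<omega>"
    and Y: "integrable M Y" "integrable M (\<lambda>\<omega>. (Y \<omega>)\<^sup>2)" "AE \<omega> in M. real_cond_exp M G Y \<omega> = 0"
    and v: "v = real_cond_exp M G (\<lambda>\<omega>. (Y \<omega>)\<^sup>2)"
    and C: "AE \<omega> in M. t \<omega> + v \<omega> \<le> C"
  shows "ennreal (\<integral>\<omega>. gauss_smooth h (t \<omega>) (S \<omega> + Y \<omega>) - gauss_smooth h (t \<omega> + v \<omega>) (S \<omega>) \<partial>M)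
    \<le> 3 * (\<integral>\<^sup>+\<omega>. ennreal (\<bar>Y \<omega>\<bar> ^ 3) / ennreal (t \<omega> + v \<omega>) \<partial>M)"
proof -
  interpret G: finite_measure_subalgebra M G by standard (rule sub)
  have vG: "v \<in> borel_measurable G" unfolding v by simp
  note hm = lipschitz_measurable[OF h]
  note fromG = measurable_from_subalg[OF sub]
  note [measurable] = hm borel_measurable_integrable[OF Y(1)] fromG[OF S(1)] fromG[OF t(1)] fromG[OF vG]
  have v0: "AE \<omega> in M. 0 \<le> v \<omega>" unfolding v by (rule G.real_cond_exp_pos) simp_all
  have vi: "integrable M v" unfolding v using Y(2) by (rule G.real_cond_exp_int)
  \<comment> \<open>The pathwise bound requires \<open>0 < v\<close>; on the set where
    \<open>v\<close> vanishes so does \<open>Y\<close> almost surely, and the coefficients are set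
    to zero there.\<close>
  define P where "P \<omega> = (if 0 < v \<omega> then drift_coeff h (t \<omega>) (v \<omega>) (S \<omega>) else 0)" for \<omega>
  define Q where "Q \<omega> = (if 0 < v \<omega> then variance_coeff h (t \<omega>) (v \<omega>) (S \<omega>) else 0)" for \<omega>
  have PG: "P \<in> borel_measurable G"
  proof -
    note [measurable] = borel_measurable_drift_coeff[OF hm t(1) S(1) vG] vG
    show ?thesis unfolding P_def[abs_def] by measurable
  qed
  have QG: "Q \<in> borel_measurable G"
  proof -
    note [measurable] = borel_measurable_variance_coeff[OF hm t(1) S(1) vG] vG
    show ?thesis unfolding Q_def[abs_def] by measurable
  qed
  note [measurable] = fromG[OF PG] fromG[OF QG]
  have zero: "AE \<omega> in M. v \<omega> = 0 \<longrightarrow> Y \<omega> = 0"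
  proof -
    \<comment> \<open>The indicator of the event \<open>v = 0\<close> is
      \<open>G\<close>-measurable, so testing the conditional variance with it gives
      \<open>Y\<^sup>2\<close> integral zero there.\<close>
    define f where "f \<omega> = (if v \<omega> = 0 then 1 else 0 :: real)" for \<omega>
    have fG: "f \<in> borel_measurable G"
    proof -
      note [measurable] = vG
      show ?thesis unfolding f_def[abs_def] by measurable
    qed
    note [measurable] = fromG[OF fG]
    have fi: "integrable M (\<lambda>\<omega>. f \<omega> * (Y \<omega>)\<^sup>2)"
      by (rule Bochner_Integration.integrable_bound[OF Y(2)]) (auto simp: f_def)
    have "(\<integral>\<omega>. f \<omega> * (Y \<omega>)\<^sup>2 \<partial>M) = (\<integral>\<omega>. f \<omega> * v \<omega> \<partial>M)"
      unfolding v by (rule G.real_cond_exp_intg(2)[symmetric, OF fi fG]) simp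
    also have "(\<lambda>\<omega>. f \<omega> * v \<omega>) = (\<lambda>\<omega>. 0)" by (auto simp: f_def)
    finally have "(\<integral>\<omega>. f \<omega> * (Y \<omega>)\<^sup>2 \<partial>M) = 0" by simp
    then have "AE \<omega> in M. f \<omega> * (Y \<omega>)\<^sup>2 = 0"
      using fi by (subst (asm) integral_nonneg_eq_0_iff_AE) (simp_all add: f_def)
    then show ?thesis by eventually_elim (auto simp: f_def)
  qed
  have P: "integrable M (\<lambda>\<omega>. P \<omega> * Y \<omega>)" "(\<integral>\<omega>. P \<omega> * Y \<omega> \<partial>M) = 0"
  proof -
    show i: "integrable M (\<lambda>\<omega>. P \<omega> * Y \<omega>)"
    proof (rule Bochner_Integration.integrable_bound[OF Y(1)])
      show "AE \<omega> in M. norm (P \<omega> * Y \<omega>) \<le> norm (Y \<omega>)"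
        using t(2)
      proof eventually_elim
        case (elim \<omega>)
        have "\<bar>P \<omega>\<bar> \<le> 1" using abs_drift_coeff_le[OF h elim] by (simp add: P_def)
        then show ?case by (simp add: abs_mult mult_left_le_one_le)
      qed
    qed measurable
    have "(\<integral>\<omega>. P \<omega> * Y \<omega> \<partial>M) = (\<integral>\<omega>. P \<omega> * real_cond_exp M G Y \<omega> \<partial>M)"
      by (rule G.real_cond_exp_intg(2)[symmetric, OF i PG]) measurable
    also have "\<dots> = (\<integral>\<omega>. 0 \<partial>M)"
      using Y(3) by (intro integral_cong_AE) auto
    finally show "(\<integral>\<omega>. P \<omega> * Y \<omega> \<partial>M) = 0" by simp
  qed
  have Q: "integrable M (\<lambda>\<omega>. Q \<omega> * (Y \<omega>)\<^sup>2)" "integrable M (\<lambda>\<omega>. Q \<omega> * v \<omega>)"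
    "(\<integral>\<omega>. Q \<omega> * v \<omega> \<partial>M) = (\<integral>\<omega>. Q \<omega> * (Y \<omega>)\<^sup>2 \<partial>M)"
  proof -
    \<comment> \<open>\<open>Q\<close> is unbounded near \<open>v = 0\<close>. Conditioning replaces
      \<open>Y\<^sup>2\<close> by \<open>v\<close> at the level of nonnegative integrals, and
      \<open>\<bar>Q\<bar> * v \<le> 5 * sqrt v \<le> 5 * (1 + v)\<close> is integrable.\<close>
    have "(\<integral>\<^sup>+\<omega>. ennreal (norm (Q \<omega> * (Y \<omega>)\<^sup>2)) \<partial>M) = (\<integral>\<^sup>+\<omega>. ennreal \<bar>Q \<omega>\<bar> * ennreal ((Y \<omega>)\<^sup>2) \<partial>M)"
      by (simp add: abs_mult ennreal_mult)
    also have "\<dots> = (\<integral>\<^sup>+\<omega>. ennreal \<bar>Q \<omega>\<bar> * nn_cond_exp M G (\<lambda>\<omega>. ennreal ((Y \<omega>)\<^sup>2)) \<omega> \<partial>M)"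
    proof (rule G.nn_cond_exp_intg[symmetric])
      note [measurable] = QG
      show "(\<lambda>\<omega>. ennreal \<bar>Q \<omega>\<bar>) \<in> borel_measurable G" by measurable
    qed measurable
    also have "\<dots> = (\<integral>\<^sup>+\<omega>. ennreal \<bar>Q \<omega>\<bar> * ennreal (v \<omega>) \<partial>M)"
      using G.nn_cond_exp_eq_real_cond_exp[OF Y(2)] by (intro nn_integral_cong_AE) (auto simp: v)
    also have "\<dots> \<le> (\<integral>\<^sup>+\<omega>. ennreal (5 * (1 + v \<omega>)) \<partial>M)"
      proof (rule nn_integral_mono_AE)
      show "AE \<omega> in M. ennreal \<bar>Q \<omega>\<bar> * ennreal (v \<omega>) \<le> ennreal (5 * (1 + v \<omega>))"
        using t(2) v0
      proof eventually_elim
        case (elim \<omega>)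
        have "\<bar>Q \<omega>\<bar> * v \<omega> \<le> 5 * (1 + v \<omega>)"
        proof (cases "0 < v \<omega>")
          case True
          have "\<bar>Q \<omega>\<bar> * v \<omega> \<le> 5 / sqrt (v \<omega>) * v \<omega>"
            using abs_variance_coeff_le[OF h elim(1) True] True by (intro mult_right_mono) (simp_all add: Q_def)
          also have "\<dots> = 5 * sqrt (v \<omega>)" using True by (simp add: field_simps)
          also have "\<dots> \<le> 5 * (1 + v \<omega>)"
            using abs_le_one_plus_square[of "sqrt (v \<omega>)"] True by simp
          finally show ?thesis .
        qed (use elim in \<open>simp add: Q_def\<close>)
        then have "ennreal (\<bar>Q \<omega>\<bar> * v \<omega>) \<le> ennreal (5 * (1 + v \<omega>))" by (rule ennreal_leI)
        then show ?case using elim by (simp only: ennreal_mult[symmetric] abs_ge_zero)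
      qed
    qed
    also have "\<dots> = ennreal (\<integral>\<omega>. 5 * (1 + v \<omega>) \<partial>M)"
      using vi v0 by (intro nn_integral_eq_integral) auto
    also have "\<dots> < \<infinity>" by simp
    finally show i: "integrable M (\<lambda>\<omega>. Q \<omega> * (Y \<omega>)\<^sup>2)"
      by (intro integrableI_bounded) measurable
    show "integrable M (\<lambda>\<omega>. Q \<omega> * v \<omega>)" "(\<integral>\<omega>. Q \<omega> * v \<omega> \<partial>M) = (\<integral>\<omega>. Q \<omega> * (Y \<omega>)\<^sup>2 \<partial>M)"
      unfolding v by (rule G.real_cond_exp_intg[OF i QG]; measurable)+
  qed
  define D where "D \<omega> = gauss_smooth h (t \<omega>) (S \<omega> + Y \<omega>) - gauss_smooth h (t \<omega> + v \<omega>) (S \<omega>)" for \<omega>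
  have D: "integrable M D"
    unfolding D_def[abs_def]
  proof (intro Bochner_Integration.integrable_diff integrable_gauss_smooth_comp[OF h])
    show "AE \<omega> in M. 0 \<le> t \<omega> \<and> t \<omega> \<le> C" using t(2) v0 C by eventually_elim auto
    show "AE \<omega> in M. 0 \<le> t \<omega> + v \<omega> \<and> t \<omega> + v \<omega> \<le> C" using t(2) v0 C by eventually_elim auto
  qed (use S Y in simp_all)
  \<comment> \<open>\<open>R\<close> has the same integral as \<open>D\<close>, but is bounded
    pathwise by the cubic term.\<close>
  define R where "R \<omega> = D \<omega> - P \<omega> * Y \<omega> - (Q \<omega> * (Y \<omega>)\<^sup>2 - Q \<omega> * v \<omega>)" for \<omega>
  have Ri: "integrable M R" unfolding R_def[abs_def] using D P Q by simp
  have "(\<integral>\<omega>. D \<omega> \<partial>M) = (\<integral>\<omega>. R \<omega> \<partial>M)"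
    unfolding R_def using D P Q by simp
  then have "ennreal (\<integral>\<omega>. D \<omega> \<partial>M) \<le> (\<integral>\<^sup>+\<omega>. ennreal (R \<omega>) \<partial>M)"
    using ennreal_integral_le_nn_integral[OF Ri] by simp
  also have "\<dots> \<le> (\<integral>\<^sup>+\<omega>. 3 * (ennreal (\<bar>Y \<omega>\<bar> ^ 3) / ennreal (t \<omega> + v \<omega>)) \<partial>M)"
  proof (rule nn_integral_mono_AE)
    show "AE \<omega> in M. ennreal (R \<omega>) \<le> 3 * (ennreal (\<bar>Y \<omega>\<bar> ^ 3) / ennreal (t \<omega> + v \<omega>))"
      using t(2) v0 zero
    proof eventually_elim
      case (elim \<omega>)
      show ?case
      \<comment> \<open>If \<open>v\<close> vanishes then \<open>Y = 0\<close>, so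
        \<open>R = 0\<close> and the bound holds even where \<open>t + v = 0\<close>. Otherwise
        \<open>t + v\<close> is positive and the division is real.\<close>
      proof (cases "v \<omega> = 0")
        case True
        with elim show ?thesis by (simp add: R_def D_def P_def Q_def)
      next
        case False
        then have "0 < v \<omega>" using elim by simp
        then have "R \<omega> \<le> 3 * \<bar>Y \<omega>\<bar> ^ 3 / (t \<omega> + v \<omega>)"
          using lindeberg_step_bound[OF h elim(1), of "v \<omega>" "S \<omega>" "Y \<omega>"]
          by (simp add: R_def D_def P_def Q_def right_diff_distrib)
        then have "ennreal (R \<omega>) \<le> ennreal (3 * (\<bar>Y \<omega>\<bar> ^ 3 / (t \<omega> + v \<omega>)))"
          by (simp add: ennreal_leI)
        also have "\<dots> = 3 * ennreal (\<bar>Y \<omega>\<bar> ^ 3 / (t \<omega> + v \<omega>))"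
          using elim by (subst ennreal_mult) simp_all
        also have "ennreal (\<bar>Y \<omega>\<bar> ^ 3 / (t \<omega> + v \<omega>)) = ennreal (\<bar>Y \<omega>\<bar> ^ 3) / ennreal (t \<omega> + v \<omega>)"
          using elim \<open>0 < v \<omega>\<close> by (intro divide_ennreal[symmetric]) simp_all
        finally show ?thesis .
      qed
    qed
  qed
  also have "\<dots> = 3 * (\<integral>\<^sup>+\<omega>. ennreal (\<bar>Y \<omega>\<bar> ^ 3) / ennreal (t \<omega> + v \<omega>) \<partial>M)"
    by (rule nn_integral_cmult) measurable
  finally show ?thesis by (simp add: D_def)
qed

subsection \<open>Telescoping along the martingale\<close>

text \<open>\<open>ennreal\<close> truncates negative reals to zero, so for summands of arbitrary
  sign additivity weakens to this inequality.\<close>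

lemma ennreal_add_le: "ennreal (x + y) \<le> ennreal x + ennreal y"
proof (cases "0 \<le> x \<and> 0 \<le> y")
  case False
  then consider "x \<le> 0" | "y \<le> 0" by linarith
  then show ?thesis
  proof cases
    case 1
    then have "ennreal (x + y) \<le> ennreal y" by (intro ennreal_leI) simp
    then show ?thesis using 1 by (simp add: ennreal_neg)
  next
    case 2
    then have "ennreal (x + y) \<le> ennreal x" by (intro ennreal_leI) simp
    then show ?thesis using 2 by (simp add: ennreal_neg)
  qed
qed simp

lemma ennreal_sum_le: "ennreal (\<Sum>i\<in>I. f i) \<le> (\<Sum>i\<in>I. ennreal (f i))"
proof (induction I rule: infinite_finite_induct)
  case (insert i I)
  then show ?case by (auto intro: order_trans[OF ennreal_add_le] add_left_mono)
qed simp_all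

text \<open>The setting before normalisation: \<open>s2\<close> is the constant value of
  \<open>V_sq\<close> at \<open>n\<close> and becomes \<open>s_sq M X n\<close> in the
  theorem.\<close>

locale martingale_constant_quadratic_variation = prob_space M
  for M :: "'a measure" +
  fixes n :: nat and F :: "nat \<Rightarrow> 'a measure" and X :: "nat \<Rightarrow> 'a \<Rightarrow> real" and s2 a :: real
  assumes mds: "martingale_difference_sequence M n F X"
    and square_integrable: "\<And>k. k \<in> {1..n} \<Longrightarrow> integrable M (\<lambda>\<omega>. (X k \<omega>)\<^sup>2)"
    and s2: "0 \<le> s2"
    and V_n: "AE \<omega> in M. V_sq M F X n \<omega> = s2"
    and a: "0 \<le> a"
begin

lemma subalgebra_space: "k \<le> n \<Longrightarrow> subalgebra M (F k)"
  and subalgebra_filtration: "i \<le> j \<Longrightarrow> j \<le> n \<Longrightarrow> subalgebra (F j) (F i)"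
  using mds by (auto simp: martingale_difference_sequence_def finite_filtration_def)

lemma difference: "k \<in> {1..n} \<Longrightarrow> X k \<in> borel_measurable (F k)"
  "k \<in> {1..n} \<Longrightarrow> integrable M (X k)"
  "k \<in> {1..n} \<Longrightarrow> AE \<omega> in M. real_cond_exp M (F (k - 1)) (X k) \<omega> = 0"
  using mds by (auto simp: martingale_difference_sequence_def)

lemma partial_sum_measurable: "k \<le> n \<Longrightarrow> partial_sum X k \<in> borel_measurable (F k)"
  unfolding partial_sum_def[abs_def]
  by (intro borel_measurable_sum measurable_from_subalg[OF subalgebra_filtration difference(1)]) auto

lemma partial_sum_integrable: "k \<le> n \<Longrightarrow> integrable M (partial_sum X k)"
  unfolding partial_sum_def[abs_def] by (intro Bochner_Integration.integrable_sum difference) auto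

text \<open>Predictability: the last conditional variance in the sum is already given
  \<open>F (k - 1)\<close>. At \<open>k = 0\<close> the index truncates to \<open>0\<close> and the
  sum is empty.\<close>

lemma V_sq_measurable: "k \<le> n \<Longrightarrow> V_sq M F X k \<in> borel_measurable (F (k - 1))"
  unfolding V_sq_def[abs_def] cond_var_def
  by (intro borel_measurable_sum measurable_from_subalg[OF subalgebra_filtration borel_measurable_cond_exp]) auto

text \<open>This is \<open>T\<^sub>k\<close>. Almost surely it equals \<open>rho_sq\<close> at
  \<open>k + 1\<close> plus \<open>a\<^sup>2\<close>, for \<open>k \<le> n\<close>.\<close>

definition remaining_var :: "nat \<Rightarrow> 'a \<Rightarrow> real" where
  "remaining_var k \<omega> = s2 + a\<^sup>2 - V_sq M F X k \<omega>"

lemma remaining_var_measurable: "k \<le> n \<Longrightarrow> remaining_var k \<in> borel_measurable (F (k - 1))"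
  unfolding remaining_var_def[abs_def] using V_sq_measurable by simp

lemma remaining_var_pred: "1 \<le> k \<Longrightarrow> remaining_var (k - 1) \<omega> = remaining_var k \<omega> + cond_var M F X k \<omega>"
  by (cases k) (simp_all add: remaining_var_def V_sq_def)

text \<open>Conditional variances are nonnegative almost surely, so \<open>V_sq\<close> increases in
  \<open>k\<close> from \<open>0\<close> to \<open>s2\<close>.\<close>

lemma remaining_var_bounds: "AE \<omega> in M. \<forall>k\<le>n. 0 \<le> remaining_var k \<omega> \<and> remaining_var k \<omega> \<le> s2 + a\<^sup>2"
proof -
  have "AE \<omega> in M. \<forall>i\<in>{1..n}. 0 \<le> cond_var M F X i \<omega>"
  proof (rule AE_finite_allI)
    fix i assume i: "i \<in> {1..n}"
    interpret G: finite_measure_subalgebra M "F (i - 1)" by standard (rule subalgebra_space, use i in auto)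
    show "AE \<omega> in M. 0 \<le> cond_var M F X i \<omega>"
      unfolding cond_var_def using square_integrable[OF i] by (intro G.real_cond_exp_pos) auto
  qed simp
  with V_n show ?thesis
  proof eventually_elim
    case (elim \<omega>)
    show ?case
    proof (intro allI impI)
      fix k assume "k \<le> n"
      then have "V_sq M F X k \<omega> \<le> V_sq M F X n \<omega>"
        unfolding V_sq_def using elim by (intro sum_mono2) auto
      moreover have "0 \<le> V_sq M F X k \<omega>"
        unfolding V_sq_def using elim \<open>k \<le> n\<close> by (intro sum_nonneg) auto
      moreover have "0 \<le> a\<^sup>2" by simp
      ultimately show "0 \<le> remaining_var k \<omega> \<and> remaining_var k \<omega> \<le> s2 + a\<^sup>2"
        using elim unfolding remaining_var_def by argo
    qed
  qed
qed

text \<open>\<open>lindeberg_step\<close> applies with \<open>t = remaining_var k\<close>: adding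
  the conditional variance gives \<open>remaining_var (k - 1)\<close>, which is both the earlier
  smoothing time and the denominator.\<close>

lemma smoothed_step:
  assumes h: "1-lipschitz_on UNIV h" and k: "k \<in> {1..n}"
  shows "ennreal ((\<integral>\<omega>. gauss_smooth h (remaining_var k \<omega>) (partial_sum X k \<omega>) \<partial>M)
      - (\<integral>\<omega>. gauss_smooth h (remaining_var (k - 1) \<omega>) (partial_sum X (k - 1) \<omega>) \<partial>M))
    \<le> 3 * (\<integral>\<^sup>+\<omega>. ennreal (\<bar>X k \<omega>\<bar> ^ 3) / ennreal (rho_sq M n F X k \<omega> + a\<^sup>2) \<partial>M)"
proof -
  have kn: "k \<le> n" "k - 1 \<le> n" "1 \<le> k" using k by auto
  have int: "integrable M (\<lambda>\<omega>. gauss_smooth h (remaining_var j \<omega>) (partial_sum X j \<omega>))" if "j \<le> n" for j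
  proof (rule integrable_gauss_smooth_comp[OF h])
    show "random_variable borel (remaining_var j)"
      using measurable_from_subalg[OF subalgebra_space remaining_var_measurable[OF that]] that by simp
    show "AE \<omega> in M. 0 \<le> remaining_var j \<omega> \<and> remaining_var j \<omega> \<le> s2 + a\<^sup>2"
      using remaining_var_bounds by eventually_elim (use that in auto)
  qed (rule partial_sum_integrable[OF that])
  have sum: "partial_sum X k \<omega> = partial_sum X (k - 1) \<omega> + X k \<omega>" for \<omega>
    using kn by (cases k) (simp_all add: partial_sum_def)
  have "ennreal (\<integral>\<omega>. gauss_smooth h (remaining_var k \<omega>) (partial_sum X (k - 1) \<omega> + X k \<omega>)
        - gauss_smooth h (remaining_var k \<omega> + cond_var M F X k \<omega>) (partial_sum X (k - 1) \<omega>) \<partial>M)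
      \<le> 3 * (\<integral>\<^sup>+\<omega>. ennreal (\<bar>X k \<omega>\<bar> ^ 3) / ennreal (remaining_var k \<omega> + cond_var M F X k \<omega>) \<partial>M)"
  proof (rule lindeberg_step[where G = "F (k - 1)" and C = "s2 + a\<^sup>2"])
    show "1-lipschitz_on UNIV h" by (rule h)
    show "subalgebra M (F (k - 1))" by (rule subalgebra_space[OF kn(2)])
    show "partial_sum X (k - 1) \<in> borel_measurable (F (k - 1))" "integrable M (partial_sum X (k - 1))"
      by (rule partial_sum_measurable[OF kn(2)] partial_sum_integrable[OF kn(2)])+
    show "remaining_var k \<in> borel_measurable (F (k - 1))"
      by (rule remaining_var_measurable[OF kn(1)])
    show "integrable M (X k)" "integrable M (\<lambda>\<omega>. (X k \<omega>)\<^sup>2)" "AE \<omega> in M. real_cond_exp M (F (k - 1)) (X k) \<omega> = 0"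
      by (rule difference[OF k] square_integrable[OF k])+
    show "cond_var M F X k = real_cond_exp M (F (k - 1)) (\<lambda>\<omega>. (X k \<omega>)\<^sup>2)"
      by (rule cond_var_def)
    show "AE \<omega> in M. 0 \<le> remaining_var k \<omega>"
      using remaining_var_bounds by eventually_elim (use kn in auto)
    show "AE \<omega> in M. remaining_var k \<omega> + cond_var M F X k \<omega> \<le> s2 + a\<^sup>2"
      unfolding remaining_var_pred[OF kn(3), symmetric]
      using remaining_var_bounds by eventually_elim (use kn in auto)
  qed
  also have "(\<integral>\<^sup>+\<omega>. ennreal (\<bar>X k \<omega>\<bar> ^ 3) / ennreal (remaining_var k \<omega> + cond_var M F X k \<omega>) \<partial>M)
      = (\<integral>\<^sup>+\<omega>. ennreal (\<bar>X k \<omega>\<bar> ^ 3) / ennreal (rho_sq M n F X k \<omega> + a\<^sup>2) \<partial>M)"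
    unfolding remaining_var_pred[OF kn(3), symmetric]
    using V_n by (intro nn_integral_cong_AE) (auto simp: remaining_var_def rho_sq_def algebra_simps)
  finally show ?thesis
    by (simp only: remaining_var_pred[OF kn(3), symmetric] sum[symmetric]
        Bochner_Integration.integral_diff[OF int[OF kn(1)] int[OF kn(2)]])
qed

lemma one_sided_bound:
  assumes h: "1-lipschitz_on UNIV h"
  shows "ennreal ((\<integral>\<omega>. h (partial_sum X n \<omega>) \<partial>M) - gauss_smooth h s2 0)
    \<le> 3 * (\<Sum>k=1..n. \<integral>\<^sup>+\<omega>. ennreal (\<bar>X k \<omega>\<bar> ^ 3) / ennreal (rho_sq M n F X k \<omega> + a\<^sup>2) \<partial>M) + ennreal (2 * a)"
proof -
  define U where "U k = (\<integral>\<omega>. gauss_smooth h (remaining_var k \<omega>) (partial_sum X k \<omega>) \<partial>M)" for k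
  note [measurable] = lipschitz_measurable[OF h] borel_measurable_integrable[OF partial_sum_integrable[OF order_refl]]
  have int: "integrable M (\<lambda>\<omega>. gauss_smooth h t (partial_sum X n \<omega>))" if "0 \<le> t" for t
    by (rule integrable_gauss_smooth_comp[OF h, where C=t]) (use that partial_sum_integrable in auto)
  have Un: "U n = (\<integral>\<omega>. gauss_smooth h (a\<^sup>2) (partial_sum X n \<omega>) \<partial>M)"
  proof -
    have [measurable]: "random_variable borel (remaining_var n)"
      by (rule measurable_from_subalg[OF subalgebra_space remaining_var_measurable[OF order_refl]]) simp
    show ?thesis
      unfolding U_def
    proof (rule integral_cong_AE)
      show "AE \<omega> in M. gauss_smooth h (remaining_var n \<omega>) (partial_sum X n \<omega>) = gauss_smooth h (a\<^sup>2) (partial_sum X n \<omega>)"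
        using V_n by eventually_elim (simp add: remaining_var_def)
    qed measurable
  qed
  \<comment> \<open>At time \<open>n\<close> the smoothing left over is \<open>a\<^sup>2\<close>,
    and undoing it costs \<open>sqrt (a\<^sup>2) = a\<close>.\<close>
  have end_n: "(\<integral>\<omega>. h (partial_sum X n \<omega>) \<partial>M) - U n \<le> a"
  proof -
    have "(\<integral>\<omega>. h (partial_sum X n \<omega>) \<partial>M) - U n = (\<integral>\<omega>. gauss_smooth h 0 (partial_sum X n \<omega>) - gauss_smooth h (a\<^sup>2) (partial_sum X n \<omega>) \<partial>M)"
      unfolding Un using int[of 0] int[of "a\<^sup>2"] by simp
    also have "\<dots> \<le> (\<integral>\<omega>. a \<partial>M)"
    proof (rule integral_mono)
      show "gauss_smooth h 0 (partial_sum X n \<omega>) - gauss_smooth h (a\<^sup>2) (partial_sum X n \<omega>) \<le> a" for \<omega>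
        using gauss_smooth_time_le[OF h, of 0 "partial_sum X n \<omega>" "a\<^sup>2"] a by (simp add: abs_le_iff)
      show "integrable M (\<lambda>\<omega>. gauss_smooth h 0 (partial_sum X n \<omega>) - gauss_smooth h (a\<^sup>2) (partial_sum X n \<omega>))"
        using int[of 0] int[of "a\<^sup>2"] by simp
    qed simp
    finally show ?thesis by (simp add: prob_space)
  qed
  have end_0: "U 0 - gauss_smooth h s2 0 \<le> a"
  proof -
    have "U 0 = gauss_smooth h (s2 + a\<^sup>2) 0"
      by (simp add: U_def remaining_var_def V_sq_def partial_sum_def prob_space)
    \<comment> \<open>Subadditivity of the square root gives the second cost \<open>a\<close>, for
      removing the extra time at the start.\<close>
    moreover have "\<bar>sqrt (s2 + a\<^sup>2) - sqrt s2\<bar> \<le> a"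
      using sqrt_add_le_add_sqrt[OF s2, of "a\<^sup>2"] a s2 by simp
    ultimately show ?thesis
      using gauss_smooth_time_le[OF h, of "s2 + a\<^sup>2" 0 s2] by simp
  qed
  have "U n - U 0 = (\<Sum>k=1..n. U k - U (k - 1))"
    using sum_telescope''[of 0 n U] by simp
  then have "ennreal (U n - U 0) \<le> (\<Sum>k=1..n. ennreal (U k - U (k - 1)))"
    by (simp only: ennreal_sum_le)
  also have "\<dots> \<le> (\<Sum>k=1..n. 3 * (\<integral>\<^sup>+\<omega>. ennreal (\<bar>X k \<omega>\<bar> ^ 3) / ennreal (rho_sq M n F X k \<omega> + a\<^sup>2) \<partial>M))"
    unfolding U_def by (intro sum_mono smoothed_step[OF h])
  finally have main: "ennreal (U n - U 0)
      \<le> 3 * (\<Sum>k=1..n. \<integral>\<^sup>+\<omega>. ennreal (\<bar>X k \<omega>\<bar> ^ 3) / ennreal (rho_sq M n F X k \<omega> + a\<^sup>2) \<partial>M)"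
    by (simp only: sum_distrib_left)
  have "ennreal ((\<integral>\<omega>. h (partial_sum X n \<omega>) \<partial>M) - gauss_smooth h s2 0) \<le> ennreal ((U n - U 0) + 2 * a)"
    using end_n end_0 by (intro ennreal_leI) argo
  also have "\<dots> \<le> ennreal (U n - U 0) + ennreal (2 * a)"
    by (rule ennreal_add_le)
  finally show ?thesis using add_right_mono[OF main] by (rule order_trans)
qed

text \<open>\<open>- h\<close> is again 1-Lipschitz and smoothing is linear, so the one-sided bound
  for both functions controls the absolute value.\<close>

lemma two_sided_bound:
  assumes h: "1-lipschitz_on UNIV h"
  shows "ennreal \<bar>(\<integral>\<omega>. h (partial_sum X n \<omega>) \<partial>M) - gauss_smooth h s2 0\<bar>
    \<le> 3 * (\<Sum>k=1..n. \<integral>\<^sup>+\<omega>. ennreal (\<bar>X k \<omega>\<bar> ^ 3) / ennreal (rho_sq M n F X k \<omega> + a\<^sup>2) \<partial>M) + ennreal (2 * a)"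
proof -
  have "1-lipschitz_on UNIV (\<lambda>x. - h x)"
    using h by (simp add: lipschitz_on_def dist_real_def abs_minus_commute)
  from one_sided_bound[OF h] one_sided_bound[OF this] show ?thesis
    by (cases "0 \<le> (\<integral>\<omega>. h (partial_sum X n \<omega>) \<partial>M) - gauss_smooth h s2 0")
      (simp_all add: gauss_smooth_def)
qed

end

section \<open>Rescaling to the normalised sum\<close>

theorem theorem2p1:
  fixes M :: "'a measure" and F :: "nat \<Rightarrow> 'a measure"
    and X :: "nat \<Rightarrow> 'a \<Rightarrow> real" and n :: nat and a :: real
  assumes "prob_space M"
    and "1 \<le> n"
    and "martingale_difference_sequence M n F X"
    and "\<And>k. k \<in> {1..n} \<Longrightarrow> integrable M (\<lambda>\<omega>. (X k \<omega>)\<^sup>2)"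
    and "0 < s_sq M X n"
    and "AE \<omega> in M. V_sq M F X n \<omega> = s_sq M X n"
    and "0 \<le> a"
  shows "wasserstein_dist
           (distr M borel (\<lambda>\<omega>. partial_sum X n \<omega> / sqrt (s_sq M X n)))
           std_normal_distribution
         \<le> ennreal (3 / sqrt (s_sq M X n)) *
             (\<Sum>k=1..n. \<integral>\<^sup>+ \<omega>. ennreal (\<bar>X k \<omega>\<bar> ^ 3) / ennreal (rho_sq M n F X k \<omega> + a\<^sup>2) \<partial>M)
           + ennreal (2 * a / sqrt (s_sq M X n))"
  unfolding wasserstein_dist_def
proof (rule SUP_least)
  fix h :: "real \<Rightarrow> real" assume "h \<in> {h. 1-lipschitz_on UNIV h}"
  then have h: "1-lipschitz_on UNIV h" by simp
  note [measurable] = lipschitz_measurable[OF h]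
  define s where "s = sqrt (s_sq M X n)"
  have s: "0 < s" using assms(5) by (simp add: s_def)
  interpret martingale_constant_quadratic_variation M n F X "s_sq M X n" a
    by (intro martingale_constant_quadratic_variation.intro
        martingale_constant_quadratic_variation_axioms.intro less_imp_le[OF assms(5)] assms)
  have [measurable]: "random_variable borel (partial_sum X n)"
    by (rule borel_measurable_integrable[OF partial_sum_integrable[OF order_refl]])
  \<comment> \<open>This rescaling keeps the Lipschitz constant \<open>1\<close>. Both expectations
    of \<open>h\<close> are those of \<open>g\<close> divided by \<open>s\<close>: at
    \<open>partial_sum X n\<close>, and smoothed from \<open>0\<close> for time
    \<open>s\<^sup>2\<close>.\<close>
  define g where "g x = s * h (x / s)" for x
  have g: "1-lipschitz_on UNIV g"
  proof (rule lipschitz_onI)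
    show "dist (g x) (g y) \<le> 1 * dist x y" for x y
      using mult_left_mono[OF lipschitz_abs_le[OF h, of "x / s" "y / s"], of s] s
      by (simp add: g_def dist_real_def abs_mult flip: right_diff_distrib diff_divide_distrib)
  qed simp
  let ?R = "\<Sum>k=1..n. \<integral>\<^sup>+\<omega>. ennreal (\<bar>X k \<omega>\<bar> ^ 3) / ennreal (rho_sq M n F X k \<omega> + a\<^sup>2) \<partial>M"
  let ?P = "distr M borel (\<lambda>\<omega>. partial_sum X n \<omega> / sqrt (s_sq M X n))"
  have "(\<integral>x. h x \<partial>?P) = (\<integral>\<omega>. g (partial_sum X n \<omega>) \<partial>M) / s"
    using s by (simp add: integral_distr g_def s_def[symmetric])
  moreover have "(\<integral>x. h x \<partial>gauss) = gauss_smooth g (s_sq M X n) 0 / s"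
    using s by (simp add: gauss_smooth_def g_def s_def[symmetric])
  ultimately have "\<bar>(\<integral>x. h x \<partial>?P) - (\<integral>x. h x \<partial>gauss)\<bar>
      = 1 / s * \<bar>(\<integral>\<omega>. g (partial_sum X n \<omega>) \<partial>M) - gauss_smooth g (s_sq M X n) 0\<bar>"
    using s by (simp flip: diff_divide_distrib)
  then have "ennreal \<bar>(\<integral>x. h x \<partial>?P) - (\<integral>x. h x \<partial>gauss)\<bar>
      = ennreal (1 / s) * ennreal \<bar>(\<integral>\<omega>. g (partial_sum X n \<omega>) \<partial>M) - gauss_smooth g (s_sq M X n) 0\<bar>"
    using s by (simp only: ennreal_mult' zero_le_divide_1_iff less_imp_le)
  also have "\<dots> \<le> ennreal (1 / s) * (3 * ?R + ennreal (2 * a))"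
    by (intro mult_left_mono two_sided_bound g) simp
  also have "\<dots> = ennreal (1 / s) * ennreal 3 * ?R + ennreal (1 / s) * ennreal (2 * a)"
    by (simp add: distrib_left mult.assoc)
  also have "\<dots> = ennreal (3 / s) * ?R + ennreal (2 * a / s)"
    using s a by (simp only: ennreal_mult'[symmetric] zero_le_divide_1_iff less_imp_le) simp
  finally show "ennreal \<bar>(\<integral>x. h x \<partial>?P) - (\<integral>x. h x \<partial>std_normal_distribution)\<bar>
      \<le> ennreal (3 / sqrt (s_sq M X n)) * ?R + ennreal (2 * a / sqrt (s_sq M X n))"
    by (simp only: s_def)
qed

end
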